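(* Fix $p\ge1$, and let $X$ be a real random variable with $0<\mathbb{E}|X|^{3p}<\infty$ and $\sigma_p>0$. Let $\{n(d)\}_{d\ge1}$ be any sequence of positive integers converging to infinity and satisfying $$n(d)=o\left(\frac{d^{1/5}}{\log^{6/5}d}\right),\quad\text{as } d\to\infty.$$ For each $d$, let $\mathbf{X}_1,\dots,\mathbf{X}_{n(d)}$ be i.i.d. random vectors in $\mathbb{R}^d$, each having i.i.d. components distributed as $X$. Then, as $d\to\infty$, $$\frac{p\,a_{n(d)}\,d^{1/2-1/p}}{\mu_p^{1/p-1}\sigma_p}\left(\max_{1\le i\le n(d)}\Vert\mathbf{X}_i\Vert_p-\min_{1\le i\le n(d)}\Vert\mathbf{X}_i\Vert_p\right)-2a_{n(d)}b_{n(d)}\xrightarrow{\mathcal{D}}E+E',$$ where $$a_n=\sqrt{2\log n},\qquad b_n=\sqrt{2\log n}-\frac12\,\frac{\log\log n+\log 4\pi}{\sqrt{2\log n}},$$ and $E$, $E'$ are independent, identically distributed random variables with $\mathbb{P}\{E\le x\}=\exp(-\exp(-x))$ for $-\infty<x<\infty$.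
   Context: For $\mathbf{x}=(x_1,\dots,x_d)\in\mathbb{R}^d$ and $0<p<\infty$, $\Vert\mathbf{x}\Vert_p=\left(\sum_{j=1}^d|x_j|^p\right)^{1/p}$. Notation: $\mu_p=\mathbb{E}|X|^p$, $\sigma_p^2=\operatorname{Var}|X|^p$, $\sigma_p\ge0$. The symbol $\xrightarrow{\mathcal{D}}$ denotes convergence in distribution. The quantities $a_n,b_n$ are considered for $n\ge2$, which holds for $n=n(d)$ with $d$ large. *)

theory Defs
  imports "HOL-Probability.Probability" "HOL-Library.Landau_Symbols"
begin

definition iid_vars :: "'a measure \<Rightarrow> 'b measure \<Rightarrow> ('i \<Rightarrow> 'a \<Rightarrow> 'b) \<Rightarrow> 'i set \<Rightarrow> bool" where
  "iid_vars M S Y I \<longleftrightarrow> prob_space.indep_vars M (\<lambda>_. S) Y I \<and>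
     (\<forall>i\<in>I. \<forall>j\<in>I. distr M S (Y i) = distr M S (Y j))"

(* The dimension d varies with the limit, so vectors of R^d are functions on {1..d},
   carried by the product sigma-algebra (the Borel sigma-algebra of R^d). *)
abbreviation borel_vec :: "nat \<Rightarrow> (nat \<Rightarrow> real) measure" where
  "borel_vec d \<equiv> Pi\<^sub>M {1..d} (\<lambda>_. borel)"

definition lp_norm :: "real \<Rightarrow> nat \<Rightarrow> (nat \<Rightarrow> real) \<Rightarrow> real" where
  "lp_norm p d x = (\<Sum>j=1..d. \<bar>x j\<bar> powr p) powr (1 / p)"

definition abs_moment :: "'a measure \<Rightarrow> ('a \<Rightarrow> real) \<Rightarrow> real \<Rightarrow> real" where
  "abs_moment M X p = prob_space.expectation M (\<lambda>\<omega>. \<bar>X \<omega>\<bar> powr p)"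

definition abs_sd :: "'a measure \<Rightarrow> ('a \<Rightarrow> real) \<Rightarrow> real \<Rightarrow> real" where
  "abs_sd M X p = sqrt (prob_space.variance M (\<lambda>\<omega>. \<bar>X \<omega>\<bar> powr p))"

(* Normalizing constants for the maximum of n standard normal variables; meant for n >= 2. *)
definition a_norm :: "nat \<Rightarrow> real" where
  "a_norm n = sqrt (2 * ln (real n))"

definition b_norm :: "nat \<Rightarrow> real" where
  "b_norm n = sqrt (2 * ln (real n))
     - 1 / 2 * ((ln (ln (real n)) + ln (4 * pi)) / sqrt (2 * ln (real n)))"

end

(* Writing S_i for the standardized sum of the |X_ij|^p, the norm ||X_i||_p is an increasing function
   of S_i, so bounds on the maximum and the minimum of the norms say that every S_i lies in a fixed
   interval, and by independence the joint law only involves n P(S > u) and n P(S < -v).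
   These are compared with Gaussian tails by Lindeberg's replacement method, with a smooth step
   function of width eps / a_n: on this scale the Gumbel limit moves by a factor tending to 1 as
   eps -> 0, and the replacement costs n a_n^3 / sqrt d -> 0. Thus one-dimensional replacement
   suffices and no multivariate central limit theorem is used. *)

theory Submission
  imports Defs "HOL-Real_Asymp.Real_Asymp"
begin

section \<open>A smooth step function and the normal law\<close>

text \<open>The tails in question have probability of order 1/n, yet an additive comparison with the
  normal law is enough, because the error is only multiplied by n afterwards. The third-order error
  of the replacement asks for the third moment of |X|^p, that is, for E|X|^(3p). The norm is a
  nonlinear function of S_i. At heights of order a_n the second-order term of the p-th root
  displaces a level by O(a_n^2 / sqrt d), hence by O(a_n^3 / sqrt d) on the Gumbel scale, which
  vanishes as well. Asymptotic independence of maximum and minimum comes from one computation: for a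
  single vector, lying above the upper level and lying below the lower level are disjoint events, so
  their probabilities add up to some r, and (1 - r)^n tends to exp(-(e^(-x) + e^(-y))), a product of
  two Gumbel distribution functions. The probability space may change with d, so the passage from
  the pair (maximum, minus minimum) to its sum uses joint distribution functions alone: the
  half-plane u + v <= z is approximated by a staircase of vertical half-strips.\<close>

lemma taylor2_lipschitz:
  fixes f f' f'' :: "real \<Rightarrow> real"
  assumes f: "\<And>x. (f has_real_derivative f' x) (at x)"
    and f': "\<And>x. (f' has_real_derivative f'' x) (at x)"
    and L: "\<And>x y. \<bar>f'' x - f'' y\<bar> \<le> L * \<bar>x - y\<bar>"
  shows "\<bar>f (x + h) - (f x + f' x * h + f'' x * h\<^sup>2 / 2)\<bar> \<le> L * \<bar>h\<bar> ^ 3 / 2"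
proof (cases "h = 0")
  case False
  \<comment> \<open>Lagrange's form is used at order two, leaving the remainder
    \<open>(f'' t - f'' x) * h^2 / 2\<close>. So \<open>f''\<close> need only be Lipschitz, which
    matters because the third derivative of the spline jumps at the knots.\<close>
  define D where "D = (\<lambda>k::nat. if k = 0 then f else if k = 1 then f' else f'')"
  have "\<exists>t. (if x + h < x then x + h < t \<and> t < x else x < t \<and> t < x + h) \<and>
      f (x + h) = (\<Sum>m<2. (D m x / fact m) * (x + h - x) ^ m) + (D 2 t / fact 2) * (x + h - x) ^ 2"
    by (rule Taylor[where a = "min x (x + h)" and b = "max x (x + h)"])
       (use False f f' in \<open>auto simp: D_def less_2_cases_iff\<close>)
  then obtain t where t: "if x + h < x then x + h < t \<and> t < x else x < t \<and> t < x + h"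
    and eq: "f (x + h) = (\<Sum>m<2. (D m x / fact m) * (x + h - x) ^ m) + (D 2 t / fact 2) * (x + h - x) ^ 2"
    by blast
  have "f (x + h) - (f x + f' x * h + f'' x * h\<^sup>2 / 2) = (f'' t - f'' x) * h\<^sup>2 / 2"
    using eq by (simp add: D_def numeral_2_eq_2 field_simps)
  then have "\<bar>f (x + h) - (f x + f' x * h + f'' x * h\<^sup>2 / 2)\<bar> = \<bar>f'' t - f'' x\<bar> * h\<^sup>2 / 2"
    by (simp only: abs_mult abs_divide) simp
  also have "\<dots> \<le> (L * \<bar>h\<bar>) * h\<^sup>2 / 2"
  proof -
    have "L \<ge> 0" using L[of 0 1] by (simp add: order_trans[OF abs_ge_zero])
    moreover have "\<bar>t - x\<bar> \<le> \<bar>h\<bar>" using t by (auto split: if_splits)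
    ultimately have "\<bar>f'' t - f'' x\<bar> \<le> L * \<bar>h\<bar>"
      using L[of t x] by (meson mult_left_mono order_trans)
    then show ?thesis by (intro divide_right_mono mult_right_mono) auto
  qed
  also have "\<dots> = L * \<bar>h\<bar> ^ 3 / 2"
    using power2_abs[of h] power_Suc[of "\<bar>h\<bar>" 2] by (simp add: numeral_3_eq_3 numeral_2_eq_2)
  finally show ?thesis .
qed auto

text \<open>Away from 0 the function agrees locally with \<open>x ^ (k + 2)\<close> or with 0. At
  the kink the difference quotient is at most \<open>\<bar>h\<bar> ^ (k + 1)\<close>, so an exponent
  of at least two makes it vanish.\<close>

lemma DERIV_max_power:
  "((\<lambda>x::real. max 0 x ^ (k + 2)) has_real_derivative real (k + 2) * max 0 x ^ (k + 1)) (at x)"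
proof -
  consider "x > 0" | "x < 0" | "x = 0" by linarith
  then show ?thesis
  proof cases
    case 1
    have "((\<lambda>x::real. x ^ (k + 2)) has_real_derivative real (k + 2) * x ^ (k + 1)) (at x)"
      using DERIV_pow[of "k + 2" x] by simp
    then have "((\<lambda>x::real. x ^ (k + 2)) has_real_derivative real (k + 2) * max 0 x ^ (k + 1)) (at x)"
      using 1 by simp
    then show ?thesis
      by (rule has_field_derivative_transform_within_open[of _ _ _ "{0<..}"]) (use 1 in auto)
  next
    case 2
    have "((\<lambda>x::real. 0) has_real_derivative real (k + 2) * max 0 x ^ (k + 1)) (at x)"
      using 2 by simp
    then show ?thesis
      by (rule has_field_derivative_transform_within_open[of _ _ _ "{..<0}"]) (use 2 in auto)
  next
    case 3
    have "((\<lambda>h::real. max 0 h ^ (k + 2) / h) \<longlongrightarrow> 0) (at 0)"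
    proof (rule Lim_null_comparison)
      show "\<forall>\<^sub>F h in at 0. norm (max 0 h ^ (k + 2) / h) \<le> \<bar>h\<bar> ^ (k + 1)"
        by (rule eventuallyI) (auto simp: max_def intro!: mult_nonpos_nonneg)
      show "((\<lambda>h::real. \<bar>h\<bar> ^ (k + 1)) \<longlongrightarrow> 0) (at 0)"
        by (auto intro!: tendsto_eq_intros)
    qed
    then show ?thesis using 3 by (simp add: DERIV_def)
  qed
qed

text \<open>The integral of the quadratic B-spline with knots 0, 1, 2, 3: it rises from 0 to 1 with a
  Lipschitz second derivative.\<close>

definition spline :: "real \<Rightarrow> real" where
  "spline x = (max 0 x ^ 3 - 3 * max 0 (x - 1) ^ 3 + 3 * max 0 (x - 2) ^ 3 - max 0 (x - 3) ^ 3) / 6"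

definition spline' :: "real \<Rightarrow> real" where
  "spline' x = (max 0 x ^ 2 - 3 * max 0 (x - 1) ^ 2 + 3 * max 0 (x - 2) ^ 2 - max 0 (x - 3) ^ 2) / 2"

definition spline'' :: "real \<Rightarrow> real" where
  "spline'' x = max 0 x - 3 * max 0 (x - 1) + 3 * max 0 (x - 2) - max 0 (x - 3)"

lemma spline_deriv: "(spline has_real_derivative spline' x) (at x)"
proof -
  define m where "m = (\<lambda>c x::real. max 0 (x - c) ^ 3)"
  have *: "(m c has_real_derivative 3 * max 0 (x - c) ^ 2) (at x)" for c x
    using DERIV_shift[of "\<lambda>x. max 0 x ^ 3" "3 * max 0 (x - c) ^ 2" x "- c"] DERIV_max_power[of 1 "x - c"]
    by (simp add: numeral_3_eq_3 numeral_2_eq_2 m_def)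
  have "((\<lambda>x. (m 0 x - 3 * m 1 x + 3 * m 2 x - m 3 x) / 6) has_real_derivative spline' x) (at x)"
    by (auto intro!: derivative_eq_intros * simp: spline'_def)
  then show ?thesis by (simp add: spline_def[abs_def] m_def)
qed

lemma spline'_deriv: "(spline' has_real_derivative spline'' x) (at x)"
proof -
  define m where "m = (\<lambda>c x::real. max 0 (x - c) ^ 2)"
  have *: "(m c has_real_derivative 2 * max 0 (x - c)) (at x)" for c x
    using DERIV_shift[of "\<lambda>x. max 0 x ^ 2" "2 * max 0 (x - c)" x "- c"] DERIV_max_power[of 0 "x - c"]
    by (simp add: numeral_2_eq_2 m_def)
  have "((\<lambda>x. (m 0 x - 3 * m 1 x + 3 * m 2 x - m 3 x) / 2) has_real_derivative spline'' x) (at x)"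
    by (auto intro!: derivative_eq_intros * simp: spline''_def)
  then show ?thesis by (simp add: spline'_def[abs_def] m_def)
qed

text \<open>Each truncated linear function is 1-Lipschitz, and 8 = 1 + 3 + 3 + 1 is the sum of the
  absolute coefficients. Only the finiteness of this constant matters later.\<close>

lemma spline''_lipschitz: "\<bar>spline'' x - spline'' y\<bar> \<le> 8 * \<bar>x - y\<bar>"
proof -
  define m where "m = (\<lambda>c x::real. max 0 (x - c))"
  have *: "\<bar>m c x - m c y\<bar> \<le> \<bar>x - y\<bar>" for c by (simp add: m_def max_def)
  have "spline'' z = m 0 z - 3 * m 1 z + 3 * m 2 z - m 3 z" for z
    by (simp add: spline''_def m_def)
  then show ?thesis using *[of 0] *[of 1] *[of 2] *[of 3] by (smt (verit))
qed

lemma spline_0: "x \<le> 0 \<Longrightarrow> spline x = 0"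
  by (simp add: spline_def)

lemma spline_1: "x \<ge> 3 \<Longrightarrow> spline x = 1"
  by (simp add: spline_def power3_eq_cube algebra_simps)

text \<open>Checked piece by piece between the knots. On the middle piece, with
  \<open>s = x - 1\<close>, the upper bound rests on 3 s^2 - 2 s^3 <= 1, which is (1 - s)^2 (1 + 2
  s) >= 0 expanded. These bounds allow the step to be squeezed between indicator functions of
  half-lines.\<close>

lemma spline_01: "0 \<le> spline x" "spline x \<le> 1"
proof -
  have sq: "s ^ 3 \<le> s\<^sup>2" "s\<^sup>2 \<le> s" "0 \<le> s ^ 3" if "0 \<le> s" "s \<le> 1" for s :: real
    using that power_decreasing[of 2 3 s] power_decreasing[of 1 2 s] by auto
  consider "x \<le> 0" | "0 \<le> x" "x \<le> 1" | "1 \<le> x" "x \<le> 2" | "2 \<le> x" "x \<le> 3" | "3 \<le> x" by linarith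
  then have "0 \<le> spline x \<and> spline x \<le> 1"
  proof cases
    case 2
    then show ?thesis using sq[OF 2] by (simp add: spline_def)
  next
    case 3
    define s where "s = x - 1"
    have s: "0 \<le> s" "s \<le> 1" using 3 by (auto simp: s_def)
    have "spline x = (1 + 3 * s + 3 * s\<^sup>2 - 2 * s ^ 3) / 6"
      using 3 by (simp add: spline_def s_def power3_eq_cube power2_eq_square algebra_simps)
    moreover have "3 * s\<^sup>2 - 2 * s ^ 3 \<le> 1"
    proof -
      have "0 \<le> (1 - s)\<^sup>2 * (1 + 2 * s)" using s by simp
      then show ?thesis by (simp add: power3_eq_cube power2_eq_square algebra_simps)
    qed
    moreover have "0 \<le> (1 + 3 * s + 3 * a - 2 * b) / 6 \<and> (1 + 3 * s + 3 * a - 2 * b) / 6 \<le> 1"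
      if "3 * a - 2 * b \<le> 1" "b \<le> a" "0 \<le> b" for a b
      using that s by simp
    ultimately show ?thesis using sq[OF s] s by metis
  next
    case 4
    define s where "s = 3 - x"
    have s: "0 \<le> s" "s \<le> 1" using 4 by (auto simp: s_def)
    have "spline x = 1 - s ^ 3 / 6"
      using 4 by (simp add: spline_def s_def power3_eq_cube power2_eq_square field_simps)
    then have "0 \<le> spline x" "spline x \<le> 1" using sq[OF s] s by - linarith+
    then show ?thesis ..
  qed (auto simp: spline_0 spline_1)
  then show "0 \<le> spline x" "spline x \<le> 1" by auto
qed

section \<open>Centred normal laws, indexed by standard deviation, and their convolution\<close>

definition normal_law :: "real \<Rightarrow> real measure" where
  "normal_law s = density lborel (\<lambda>x. ennreal (normal_density 0 s x))"

lemma sets_normal_law [simp, measurable_cong]: "sets (normal_law s) = sets borel"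
  by (simp add: normal_law_def)

lemma space_normal_law [simp]: "space (normal_law s) = UNIV"
  by (simp add: normal_law_def)

lemma prob_space_normal_law: "s > 0 \<Longrightarrow> prob_space (normal_law s)"
  unfolding normal_law_def by (rule prob_space_normal_density)

lemma convolution_normal_law:
  assumes "s > 0" "t > 0"
  shows "normal_law s \<star> normal_law t = normal_law (sqrt (s\<^sup>2 + t\<^sup>2))"
proof -
  interpret s: prob_space "normal_law s" by (rule prob_space_normal_law) fact
  interpret t: prob_space "normal_law t" by (rule prob_space_normal_law) fact
  have "normal_law s \<star> normal_law t = density lborel
      (\<lambda>x. \<integral>\<^sup>+y. ennreal (normal_density 0 s (x - y)) * ennreal (normal_density 0 t y) \<partial>lborel)"
    unfolding normal_law_def
    by (rule convolution_density)
       (use s.finite_measure_axioms t.finite_measure_axioms in \<open>auto simp: normal_law_def\<close>)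
  also have "\<dots> = normal_law (sqrt (s\<^sup>2 + t\<^sup>2))"
    unfolding normal_law_def using conv_normal_density_zero_mean[OF assms]
    by (auto simp: ennreal_mult[symmetric] fun_eq_iff intro!: density_cong)
  finally show ?thesis .
qed

section \<open>Lindeberg's replacement method\<close>

lemma (in prob_space) abs_expectation_le:
  fixes g :: "'a \<Rightarrow> real"
  assumes [measurable]: "g \<in> borel_measurable M" and B: "\<And>\<omega>. \<bar>g \<omega>\<bar> \<le> B"
  shows "\<bar>expectation g\<bar> \<le> B"
proof -
  have "integrable M g" by (rule integrable_const_bound[where B = B]) (auto simp: B)
  then show ?thesis
    by (intro order_trans[OF integral_abs_bound integral_le_const]) (auto simp: B)
qed

text \<open>The linear term has expectation zero, so up to a third-moment error the law of
  \<open>Y\<close> enters only through its second moment. For two centred variables with the same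
  variance the main terms are equal, and only the two error terms survive in the comparison.\<close>

lemma (in prob_space) expectation_taylor2:
  fixes f f' f'' :: "real \<Rightarrow> real"
  assumes f: "\<And>x. (f has_real_derivative f' x) (at x)"
    and f': "\<And>x. (f' has_real_derivative f'' x) (at x)"
    and L: "\<And>x y. \<bar>f'' x - f'' y\<bar> \<le> L * \<bar>x - y\<bar>"
    and B: "\<And>x. \<bar>f x\<bar> \<le> B"
    and Y [measurable]: "Y \<in> borel_measurable M"
    and int3: "integrable M (\<lambda>\<omega>. \<bar>Y \<omega>\<bar> ^ 3)"
    and int2: "integrable M (\<lambda>\<omega>. Y \<omega> ^ 2)"
    and int1: "integrable M Y"
    and mean: "expectation Y = 0"
  shows "\<bar>expectation (\<lambda>\<omega>. f (x + Y \<omega>)) - (f x + f'' x * expectation (\<lambda>\<omega>. Y \<omega> ^ 2) / 2)\<bar>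
           \<le> L / 2 * expectation (\<lambda>\<omega>. \<bar>Y \<omega>\<bar> ^ 3)"
proof -
  have cont: "continuous_on UNIV f"
    using f by (meson DERIV_isCont continuous_at_imp_continuous_on)
  note [measurable] = borel_measurable_continuous_onI[OF cont]
  have intf: "integrable M (\<lambda>\<omega>. f (x + Y \<omega>))"
    by (rule integrable_const_bound[where B = B]) (auto simp: B)
  have int: "integrable M (\<lambda>\<omega>. f x + f' x * Y \<omega> + f'' x * Y \<omega> ^ 2 / 2)"
    using int1 int2 by auto
  have eq: "expectation (\<lambda>\<omega>. f x + f' x * Y \<omega> + f'' x * Y \<omega> ^ 2 / 2)
      = f x + f'' x * expectation (\<lambda>\<omega>. Y \<omega> ^ 2) / 2"
    using int1 int2 mean by (simp add: prob_space)
  have "\<bar>expectation (\<lambda>\<omega>. f (x + Y \<omega>)) - (f x + f'' x * expectation (\<lambda>\<omega>. Y \<omega> ^ 2) / 2)\<bar>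
      = \<bar>expectation (\<lambda>\<omega>. f (x + Y \<omega>) - (f x + f' x * Y \<omega> + f'' x * Y \<omega> ^ 2 / 2))\<bar>"
    using intf int by (simp only: eq[symmetric] Bochner_Integration.integral_diff)
  also have "\<dots> \<le> expectation (\<lambda>\<omega>. \<bar>f (x + Y \<omega>) - (f x + f' x * Y \<omega> + f'' x * Y \<omega> ^ 2 / 2)\<bar>)"
    by (rule integral_abs_bound)
  also have "\<dots> \<le> expectation (\<lambda>\<omega>. L / 2 * \<bar>Y \<omega>\<bar> ^ 3)"
  proof (rule integral_mono)
    show "integrable M (\<lambda>\<omega>. \<bar>f (x + Y \<omega>) - (f x + f' x * Y \<omega> + f'' x * Y \<omega> ^ 2 / 2)\<bar>)"
      by (intro integrable_abs Bochner_Integration.integrable_diff intf int)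
  qed (use int3 taylor2_lipschitz[OF f f' L] in \<open>auto simp: field_simps\<close>)
  finally show ?thesis using int3 by simp
qed

text \<open>Fubini for the joint law of two independent variables, written with two copies of
  \<open>M\<close>. The inner integral sees \<open>Y\<close> only as a translation of the test
  function.\<close>

lemma integral_indep_sum:
  fixes Y Z :: "'a \<Rightarrow> real" and f :: "real \<Rightarrow> real"
  assumes M: "prob_space M" and ind: "prob_space.indep_var M borel Y borel Z"
    and [measurable]: "f \<in> borel_measurable borel" and B: "\<And>x. \<bar>f x\<bar> \<le> B"
  shows "(\<integral>\<omega>. f (x + (Y \<omega> + Z \<omega>)) \<partial>M) = (\<integral>\<omega>. (\<integral>\<omega>'. f (x + Y \<omega> + Z \<omega>') \<partial>M) \<partial>M)"
proof -
  interpret prob_space M by fact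
  have [measurable]: "Y \<in> borel_measurable M" "Z \<in> borel_measurable M"
    using ind by (auto dest: indep_var_rv1 indep_var_rv2)
  interpret Y: prob_space "distr M borel Y" by (rule prob_space_distr) simp
  interpret Z: prob_space "distr M borel Z" by (rule prob_space_distr) simp
  interpret YZ: pair_prob_space "distr M borel Y" "distr M borel Z" ..
  have joint: "distr M borel Y \<Otimes>\<^sub>M distr M borel Z = distr M (borel \<Otimes>\<^sub>M borel) (\<lambda>\<omega>. (Y \<omega>, Z \<omega>))"
    using ind indep_var_distribution_eq by blast
  have "(\<integral>\<omega>. f (x + (Y \<omega> + Z \<omega>)) \<partial>M)
      = (\<integral>yz. f (x + fst yz + snd yz) \<partial>(distr M (borel \<Otimes>\<^sub>M borel) (\<lambda>\<omega>. (Y \<omega>, Z \<omega>))))"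
    by (subst integral_distr) (simp_all add: add.assoc)
  also have "\<dots> = (\<integral>yz. f (x + fst yz + snd yz) \<partial>(distr M borel Y \<Otimes>\<^sub>M distr M borel Z))"
    by (simp only: joint)
  also have "\<dots> = (\<integral>y. (\<integral>z. f (x + y + z) \<partial>distr M borel Z) \<partial>distr M borel Y)"
    by (subst YZ.integral_fst'[symmetric])
       (auto intro!: YZ.P.integrable_const_bound[where B = B] simp: B)
  also have "\<dots> = (\<integral>\<omega>. (\<integral>\<omega>'. f (x + Y \<omega> + Z \<omega>') \<partial>M) \<partial>M)"
    by (simp add: integral_distr)
  finally show ?thesis .
qed

text \<open>Both orders of integration are provided: equating them exchanges a random summand with a
  normal block inside an iterated integral, and the first alone merges two normal laws.\<close>

lemma integral_convolution_real:
  fixes f :: "real \<Rightarrow> real"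
  assumes M: "prob_space M" "sets M = sets borel" and N: "prob_space N" "sets N = sets borel"
    and [measurable]: "f \<in> borel_measurable borel" and B: "\<And>x. \<bar>f x\<bar> \<le> B"
  shows "(\<integral>z. f z \<partial>(M \<star> N)) = (\<integral>x. (\<integral>y. f (x + y) \<partial>N) \<partial>M)"
    and "(\<integral>z. f z \<partial>(M \<star> N)) = (\<integral>y. (\<integral>x. f (x + y) \<partial>M) \<partial>N)"
proof -
  interpret M: prob_space M by fact
  interpret N: prob_space N by fact
  interpret MN: pair_prob_space M N ..
  note [measurable_cong] = M(2) N(2)
  have "(\<integral>z. f z \<partial>(M \<star> N)) = (\<integral>xy. f (fst xy + snd xy) \<partial>(M \<Otimes>\<^sub>M N))"
    unfolding convolution_def by (subst integral_distr) (auto simp: case_prod_beta)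
  moreover have int: "integrable (M \<Otimes>\<^sub>M N) (\<lambda>xy. f (fst xy + snd xy))"
    by (auto intro!: MN.P.integrable_const_bound[where B = B] simp: B)
  moreover have "integrable (M \<Otimes>\<^sub>M N) (\<lambda>(x, y). f (x + y))"
    using int by (simp add: case_prod_beta')
  ultimately show "(\<integral>z. f z \<partial>(M \<star> N)) = (\<integral>x. (\<integral>y. f (x + y) \<partial>N) \<partial>M)"
    and "(\<integral>z. f z \<partial>(M \<star> N)) = (\<integral>y. (\<integral>x. f (x + y) \<partial>M) \<partial>N)"
    using MN.integral_fst'[OF int] MN.integral_snd[of "\<lambda>x y. f (x + y)"] by (auto simp: case_prod_beta')
qed

text \<open>The induction is on translates of the test function, so that a summand can be replaced while
  the remaining ones are held fixed.\<close>

lemma (in prob_space) lindeberg_replacement: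
  fixes Y :: "'i \<Rightarrow> 'a \<Rightarrow> real" and f :: "real \<Rightarrow> real" and C :: real
  assumes J: "finite J" "J \<noteq> {}" and ind: "indep_vars (\<lambda>_. borel) Y J"
    and f [measurable]: "f \<in> borel_measurable borel" and B: "\<And>x. \<bar>f x\<bar> \<le> B" and s: "s > 0"
    and one: "\<And>j x. j \<in> J \<Longrightarrow> \<bar>expectation (\<lambda>\<omega>. f (x + Y j \<omega>)) - (\<integral>z. f (x + z) \<partial>normal_law s)\<bar> \<le> C"
  shows "\<bar>expectation (\<lambda>\<omega>. f (x + (\<Sum>j\<in>J. Y j \<omega>))) - (\<integral>z. f (x + z) \<partial>normal_law (s * sqrt (card J)))\<bar>
           \<le> card J * C"
  using J ind one
\<comment> \<open>The base case is a singleton and not the empty set: \<open>normal_law 0\<close>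
  has density zero everywhere, so it is the null measure instead of a point mass at 0.\<close>
proof (induction J arbitrary: x rule: finite_ne_induct)
  case (singleton j)
  then show ?case by simp
next
  case (insert j J)
  let ?S = "\<lambda>\<omega>. \<Sum>j\<in>J. Y j \<omega>" and ?t = "s * sqrt (card J)"
  have t: "?t > 0" using insert.hyps s by (simp add: card_gt_0_iff)
  interpret s: prob_space "normal_law s" by (rule prob_space_normal_law) fact
  interpret t: prob_space "normal_law ?t" by (rule prob_space_normal_law) fact
  have ind': "indep_vars (\<lambda>_. borel) Y J"
    by (rule indep_vars_subset[OF insert.prems(1)]) auto
  have iv: "indep_var borel (Y j) borel ?S"
    by (rule indep_vars_sum) (use insert in auto)
  have [measurable]: "Y j \<in> borel_measurable M" "?S \<in> borel_measurable M"
    using iv by (auto dest: indep_var_rv1 indep_var_rv2)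
  have IH: "\<bar>expectation (\<lambda>\<omega>. f (y + ?S \<omega>)) - (\<integral>z. f (y + z) \<partial>normal_law ?t)\<bar> \<le> card J * C" for y
    by (rule insert.IH) (use insert.prems ind' in auto)
  have bdS: "\<bar>expectation (\<lambda>\<omega>. f (y + ?S \<omega>))\<bar> \<le> B" for y
    by (rule abs_expectation_le) (auto simp: B)
  have bdt: "\<bar>\<integral>z. f (y + z) \<partial>normal_law ?t\<bar> \<le> B" for y
    by (rule t.abs_expectation_le) (auto simp: B)
  have bdY: "\<bar>expectation (\<lambda>\<omega>. f (y + Y j \<omega>))\<bar> \<le> B" for y
    by (rule abs_expectation_le) (auto simp: B)
  have bds: "\<bar>\<integral>z. f (y + z) \<partial>normal_law s\<bar> \<le> B" for y
    by (rule s.abs_expectation_le) (auto simp: B)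
  \<comment> \<open>Three stages: \<open>D1\<close> is the full sum, in \<open>D2\<close> the block
    over \<open>J\<close> has become normal while \<open>Y j\<close> is kept, and in
    \<open>D3\<close> the summand \<open>Y j\<close> has become normal too. The first change costs
    \<open>card J * C\<close>, by the induction hypothesis at the translate
    \<open>x + Y j \<omega>\<close>; the second costs \<open>C\<close>, averaged over the normal
    block.\<close>
  define D1 where "D1 = expectation (\<lambda>\<omega>. expectation (\<lambda>\<omega>'. f (x + Y j \<omega> + ?S \<omega>')))"
  define D2 where "D2 = expectation (\<lambda>\<omega>. \<integral>z. f (x + Y j \<omega> + z) \<partial>normal_law ?t)"
  define D3 where "D3 = (\<integral>z. (\<integral>w. f (x + z + w) \<partial>normal_law s) \<partial>normal_law ?t)"
  have "\<bar>D1 - D2\<bar> \<le> card J * C"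
  proof -
    have i1: "integrable M (\<lambda>\<omega>. expectation (\<lambda>\<omega>'. f (x + Y j \<omega> + ?S \<omega>')))"
      by (rule integrable_const_bound[where B = B]) (auto simp: bdS)
    have i2: "integrable M (\<lambda>\<omega>. \<integral>z. f (x + Y j \<omega> + z) \<partial>normal_law ?t)"
      by (rule integrable_const_bound[where B = B]) (auto simp: bdt)
    have "D1 - D2 = expectation (\<lambda>\<omega>. expectation (\<lambda>\<omega>'. f (x + Y j \<omega> + ?S \<omega>'))
        - (\<integral>z. f (x + Y j \<omega> + z) \<partial>normal_law ?t))"
      unfolding D1_def D2_def by (rule Bochner_Integration.integral_diff[symmetric, OF i1 i2])
    then show ?thesis
      using abs_expectation_le[OF _ IH] by simp
  qed
  moreover have "\<bar>D2 - D3\<bar> \<le> C"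
  proof -
    have ps: "prob_space (distr M borel (Y j))" by (rule prob_space_distr) simp
    have "D2 = (\<integral>y. (\<integral>z. f (x + (y + z)) \<partial>normal_law ?t) \<partial>distr M borel (Y j))"
      unfolding D2_def by (subst integral_distr) (auto simp: add.assoc)
    also have "\<dots> = (\<integral>z. (\<integral>y. f (x + (y + z)) \<partial>distr M borel (Y j)) \<partial>normal_law ?t)"
      using integral_convolution_real[of "distr M borel (Y j)" "normal_law ?t" "\<lambda>y. f (x + y)" B]
        ps t.prob_space_axioms B by simp
    also have "\<dots> = (\<integral>z. expectation (\<lambda>\<omega>. f (x + z + Y j \<omega>)) \<partial>normal_law ?t)"
      by (subst integral_distr) (auto simp: ac_simps)
    finally have D2: "D2 = (\<integral>z. expectation (\<lambda>\<omega>. f (x + z + Y j \<omega>)) \<partial>normal_law ?t)" .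
    have i1: "integrable (normal_law ?t) (\<lambda>z. expectation (\<lambda>\<omega>. f (x + z + Y j \<omega>)))"
      by (rule t.integrable_const_bound[where B = B]) (auto simp: bdY)
    have i2: "integrable (normal_law ?t) (\<lambda>z. \<integral>w. f (x + z + w) \<partial>normal_law s)"
      by (rule t.integrable_const_bound[where B = B]) (auto simp: bds)
    have "D2 - D3 = (\<integral>z. expectation (\<lambda>\<omega>. f (x + z + Y j \<omega>))
        - (\<integral>w. f (x + z + w) \<partial>normal_law s) \<partial>normal_law ?t)"
      unfolding D2 D3_def by (rule Bochner_Integration.integral_diff[symmetric, OF i1 i2])
    then show ?thesis
      using t.abs_expectation_le[OF _ insert.prems(2)[of j]] by simp
  qed
  moreover have "expectation (\<lambda>\<omega>. f (x + (\<Sum>j\<in>insert j J. Y j \<omega>))) = D1"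
    unfolding D1_def using integral_indep_sum[OF prob_space_axioms iv f B, of x] insert.hyps by simp
  moreover have "(\<integral>z. f (x + z) \<partial>normal_law (s * sqrt (card (insert j J)))) = D3"
  proof -
    have "s * sqrt (card (insert j J)) = sqrt (?t\<^sup>2 + s\<^sup>2)"
    proof -
      have e: "?t\<^sup>2 + s\<^sup>2 = s\<^sup>2 * card (insert j J)"
        using insert.hyps by (simp add: power_mult_distrib algebra_simps)
      show ?thesis using s by (simp only: e real_sqrt_mult real_sqrt_abs)
    qed
    then show ?thesis
      unfolding D3_def
      using integral_convolution_real(1)[of "normal_law ?t" "normal_law s" "\<lambda>y. f (x + y)" B]
        t.prob_space_axioms s.prob_space_axioms B t s by (simp add: convolution_normal_law add.assoc)
  qed
  moreover have "real (card (insert j J)) * C = card J * C + C"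
    using insert.hyps by (simp add: algebra_simps)
  ultimately show ?case by linarith
qed

section \<open>From smooth test functions to tail probabilities\<close>

lemma integral_normal_law:
  assumes [measurable]: "g \<in> borel_measurable borel"
  shows "(\<integral>z. g z \<partial>normal_law s) = (\<integral>z. normal_density 0 s z * (g z :: real) \<partial>lborel)"
  unfolding normal_law_def by (subst integral_density) auto

lemma integrable_normal_law:
  assumes [measurable]: "g \<in> borel_measurable borel"
  shows "integrable (normal_law s) g \<longleftrightarrow> integrable lborel (\<lambda>z. normal_density 0 s z * (g z :: real))"
  unfolding normal_law_def by (subst integrable_density) auto

lemma normal_law_moments:
  assumes s: "s > 0"
  shows "integrable (normal_law s) (\<lambda>z. z)" "(\<integral>z. z \<partial>normal_law s) = 0"
    "integrable (normal_law s) (\<lambda>z. z ^ 2)" "(\<integral>z. z ^ 2 \<partial>normal_law s) = s\<^sup>2"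
    "integrable (normal_law s) (\<lambda>z. \<bar>z\<bar> ^ 3)" "(\<integral>z. \<bar>z\<bar> ^ 3 \<partial>normal_law s) \<le> 2 * s ^ 3"
proof -
  note m1 = normal_moment_odd[OF s, of 0 0] and m2 = normal_moment_even[OF s, of 0 1]
    and m3 = normal_moment_abs_odd[OF s, of 0 1]
  show "integrable (normal_law s) (\<lambda>z. z)" "(\<integral>z. z \<partial>normal_law s) = 0"
    using m1 by (auto simp: integrable_normal_law integral_normal_law has_bochner_integral_iff)
  show "integrable (normal_law s) (\<lambda>z. z ^ 2)" "(\<integral>z. z ^ 2 \<partial>normal_law s) = s\<^sup>2"
    using m2 s by (auto simp: integrable_normal_law integral_normal_law has_bochner_integral_iff field_simps
       power2_eq_square)
  show "integrable (normal_law s) (\<lambda>z. \<bar>z\<bar> ^ 3)"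
    using m3 by (auto simp: integrable_normal_law has_bochner_integral_iff numeral_3_eq_3)
  have "(\<integral>z. \<bar>z\<bar> ^ 3 \<partial>normal_law s) = 2 * s ^ 3 * sqrt (2 / pi)"
    using m3 by (auto simp: integral_normal_law has_bochner_integral_iff numeral_3_eq_3)
  moreover have "sqrt (2 / pi) \<le> 1" using pi_ge_two by simp
  ultimately show "(\<integral>z. \<bar>z\<bar> ^ 3 \<partial>normal_law s) \<le> 2 * s ^ 3"
    using s by (simp add: mult_left_le)
qed

text \<open>Both \<open>\<bar>y\<bar>\<close> and \<open>y^2\<close> are at most
  \<open>1 + \<bar>y\<bar> ^ 3\<close>, and constants are integrable on a probability space.\<close>

lemma integrable_abs_powers:
  fixes Y :: "'a \<Rightarrow> real"
  assumes "prob_space M" and [measurable]: "Y \<in> borel_measurable M"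
    and int3: "integrable M (\<lambda>\<omega>. \<bar>Y \<omega>\<bar> ^ 3)"
  shows "integrable M Y" "integrable M (\<lambda>\<omega>. Y \<omega> ^ 2)"
proof -
  interpret prob_space M by fact
  have le: "\<bar>y\<bar> \<le> 1 + \<bar>y\<bar> ^ 3" "y\<^sup>2 \<le> 1 + \<bar>y\<bar> ^ 3" for y :: real
  proof -
    have "\<bar>y\<bar> \<le> 1 + \<bar>y\<bar> ^ 3 \<and> \<bar>y\<bar>\<^sup>2 \<le> 1 + \<bar>y\<bar> ^ 3"
    proof (cases "\<bar>y\<bar> \<le> 1")
      case True
      then show ?thesis using power_le_one[of "\<bar>y\<bar>" 2] by (smt (verit) abs_ge_zero zero_le_power)
    next
      case False
      then show ?thesis
        using power_increasing[of 1 3 "\<bar>y\<bar>"] power_increasing[of 2 3 "\<bar>y\<bar>"] by auto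
    qed
    then show "\<bar>y\<bar> \<le> 1 + \<bar>y\<bar> ^ 3" "y\<^sup>2 \<le> 1 + \<bar>y\<bar> ^ 3" by auto
  qed
  have i: "integrable M (\<lambda>\<omega>. 1 + \<bar>Y \<omega>\<bar> ^ 3)" using int3 by auto
  show "integrable M Y" "integrable M (\<lambda>\<omega>. Y \<omega> ^ 2)"
    by (rule Bochner_Integration.integrable_bound[OF i]; use le in \<open>auto simp: abs_of_nonneg\<close>)+
qed

lemma (in prob_space) expectation_indicator_mono:
  fixes f :: "real \<Rightarrow> real"
  assumes [measurable]: "Y \<in> borel_measurable M" "f \<in> borel_measurable borel"
    and f01: "\<And>x. 0 \<le> f x" "\<And>x. f x \<le> 1"
  shows "(\<And>x. x \<ge> u \<Longrightarrow> f x = 1) \<Longrightarrow> prob {\<omega>\<in>space M. u \<le> Y \<omega>} \<le> expectation (\<lambda>\<omega>. f (Y \<omega>))"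
    and "(\<And>x. x < u \<Longrightarrow> f x = 0) \<Longrightarrow> expectation (\<lambda>\<omega>. f (Y \<omega>)) \<le> prob {\<omega>\<in>space M. u \<le> Y \<omega>}"
proof -
  have i: "integrable M (\<lambda>\<omega>. f (Y \<omega>))"
    by (rule integrable_const_bound[where B = 1]) (use f01 in auto)
  have j: "integrable M (indicator {\<omega>\<in>space M. u \<le> Y \<omega>} :: 'a \<Rightarrow> real)"
    by (rule integrable_const_bound[where B = 1]) (auto simp: indicator_def)
  have e: "prob {\<omega>\<in>space M. u \<le> Y \<omega>} = expectation (indicator {\<omega>\<in>space M. u \<le> Y \<omega>})"
    by (subst Bochner_Integration.integral_indicator) (auto intro!: arg_cong[where f = prob])
  show "prob {\<omega>\<in>space M. u \<le> Y \<omega>} \<le> expectation (\<lambda>\<omega>. f (Y \<omega>))" if "\<And>x. x \<ge> u \<Longrightarrow> f x = 1"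
    unfolding e by (rule integral_mono[OF j i]) (use f01 that in \<open>auto simp: indicator_def\<close>)
  show "expectation (\<lambda>\<omega>. f (Y \<omega>)) \<le> prob {\<omega>\<in>space M. u \<le> Y \<omega>}" if "\<And>x. x < u \<Longrightarrow> f x = 0"
    unfolding e by (rule integral_mono[OF i j]) (use f01 that in \<open>auto simp: indicator_def not_le\<close>)
qed

text \<open>The indicator of a half-line is compared with a spline stretched by \<open>e\<close>;
  the shift \<open>3 * e\<close> is the length over which it rises. Stretching gives the second
  derivative the Lipschitz constant 8 / e^3, and Taylor's formula takes half of it. The third
  absolute moments of one summand and of its normal substitute are at most \<open>\<rho>\<close> and
  2 times k^(-3/2), where k is \<open>card J\<close>; adding up k replacements gives
  \<open>err\<close>.\<close>

lemma (in prob_space) sum_tail_normal: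
  fixes Y :: "'i \<Rightarrow> 'a \<Rightarrow> real"
  assumes J: "finite J" "J \<noteq> {}" and ind: "indep_vars (\<lambda>_. borel) Y J"
    and int3: "\<And>j. j \<in> J \<Longrightarrow> integrable M (\<lambda>\<omega>. \<bar>Y j \<omega>\<bar> ^ 3)"
    and mean: "\<And>j. j \<in> J \<Longrightarrow> expectation (Y j) = 0"
    and var: "\<And>j. j \<in> J \<Longrightarrow> expectation (\<lambda>\<omega>. Y j \<omega> ^ 2) = 1 / card J"
    and third: "\<And>j. j \<in> J \<Longrightarrow> expectation (\<lambda>\<omega>. \<bar>Y j \<omega>\<bar> ^ 3) \<le> \<rho> / (card J * sqrt (card J))"
    and e: "e > 0"
  defines "err \<equiv> 4 * (\<rho> + 2) / (e ^ 3 * sqrt (card J))"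
  shows "prob {\<omega>\<in>space M. u \<le> (\<Sum>j\<in>J. Y j \<omega>)} \<le> measure (normal_law 1) {u - 3 * e..} + err"
    and "measure (normal_law 1) {u + 3 * e..} - err \<le> prob {\<omega>\<in>space M. u \<le> (\<Sum>j\<in>J. Y j \<omega>)}"
proof -
  define k where "k = real (card J)"
  have k: "k > 0" using J by (simp add: k_def card_gt_0_iff)
  define s where "s = 1 / sqrt k"
  have s: "s > 0" "s\<^sup>2 = 1 / k" "s ^ 3 = 1 / (k * sqrt k)" "s * sqrt k = 1"
    using k by (auto simp: s_def power_divide power3_eq_cube)
  interpret G: prob_space "normal_law s" by (rule prob_space_normal_law) fact
  interpret G1: prob_space "normal_law 1" by (rule prob_space_normal_law) simp
  have rv [measurable]: "Y j \<in> borel_measurable M" if "j \<in> J" for j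
    using ind that by (auto simp: indep_vars_def)
  define f where "f c x = spline ((x - c) / e)" for c x
  define f' where "f' c x = spline' ((x - c) / e) / e" for c x
  define f'' where "f'' c x = spline'' ((x - c) / e) / e\<^sup>2" for c x
  have df: "(f c has_real_derivative f' c x) (at x)" "(f' c has_real_derivative f'' c x) (at x)" for c x
  proof -
    have lin: "((\<lambda>x. (x - c) / e) has_real_derivative 1 / e) (at x)"
      using e by (auto intro!: derivative_eq_intros)
    show "(f c has_real_derivative f' c x) (at x)"
      using DERIV_chain2[OF spline_deriv lin] by (simp add: f_def[abs_def] f'_def)
    show "(f' c has_real_derivative f'' c x) (at x)"
      using DERIV_cdivide[OF DERIV_chain2[OF spline'_deriv lin], of e]
      by (simp add: f'_def[abs_def] f''_def power2_eq_square)
  qed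
  have L: "\<bar>f'' c x - f'' c y\<bar> \<le> (8 / e ^ 3) * \<bar>x - y\<bar>" for c x y
  proof -
    have "\<bar>f'' c x - f'' c y\<bar> = \<bar>spline'' ((x - c) / e) - spline'' ((y - c) / e)\<bar> / e\<^sup>2"
      by (simp add: f''_def abs_divide flip: diff_divide_distrib)
    also have "\<dots> \<le> 8 * \<bar>(x - c) / e - (y - c) / e\<bar> / e\<^sup>2"
      by (intro divide_right_mono spline''_lipschitz) auto
    also have "\<bar>(x - c) / e - (y - c) / e\<bar> = \<bar>x - y\<bar> / e"
      using e by (simp add: abs_divide flip: diff_divide_distrib)
    finally show ?thesis by (simp add: power2_eq_square power3_eq_cube mult.assoc)
  qed
  have f01: "0 \<le> f c x" "f c x \<le> 1" for c x by (auto simp: f_def spline_01)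
  have B: "\<bar>f c x\<bar> \<le> 1" for c x using f01[of c x] by auto
  have mf [measurable]: "f c \<in> borel_measurable borel" for c
    using df(1)[of c] by (intro borel_measurable_continuous_onI)
      (meson DERIV_isCont continuous_at_imp_continuous_on)
  have one: "\<bar>expectation (\<lambda>\<omega>. f c (x + Y j \<omega>)) - (\<integral>z. f c (x + z) \<partial>normal_law s)\<bar>
      \<le> 4 * (\<rho> + 2) / (e ^ 3 * (k * sqrt k))" if j: "j \<in> J" for c x j
  proof -
    note iY = integrable_abs_powers[OF prob_space_axioms rv[OF j] int3[OF j]]
    have 1: "\<bar>expectation (\<lambda>\<omega>. f c (x + Y j \<omega>)) - (f c x + f'' c x * expectation (\<lambda>\<omega>. Y j \<omega> ^ 2) / 2)\<bar>
        \<le> (8 / e ^ 3) / 2 * expectation (\<lambda>\<omega>. \<bar>Y j \<omega>\<bar> ^ 3)"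
      using iY j int3 mean by (intro expectation_taylor2[OF df L B]) auto
    have 2: "\<bar>G.expectation (\<lambda>z. f c (x + z)) - (f c x + f'' c x * G.expectation (\<lambda>z. z ^ 2) / 2)\<bar>
        \<le> (8 / e ^ 3) / 2 * G.expectation (\<lambda>z. \<bar>z\<bar> ^ 3)"
      using normal_law_moments[OF s(1)] by (intro G.expectation_taylor2[OF df L B]) auto
    have v: "expectation (\<lambda>\<omega>. Y j \<omega> ^ 2) = G.expectation (\<lambda>z. z ^ 2)"
      using normal_law_moments(4)[OF s(1)] var[OF j] s by (simp add: k_def)
    have "\<bar>expectation (\<lambda>\<omega>. f c (x + Y j \<omega>)) - (\<integral>z. f c (x + z) \<partial>normal_law s)\<bar>
        \<le> (8 / e ^ 3) / 2 * expectation (\<lambda>\<omega>. \<bar>Y j \<omega>\<bar> ^ 3) + (8 / e ^ 3) / 2 * G.expectation (\<lambda>z. \<bar>z\<bar> ^ 3)"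
      using 1 2 unfolding v by linarith
    also have "\<dots> \<le> (8 / e ^ 3) / 2 * (\<rho> / (k * sqrt k)) + (8 / e ^ 3) / 2 * (2 * s ^ 3)"
      using e third[OF j] normal_law_moments(6)[OF s(1)]
      by (intro add_mono mult_left_mono) (auto simp: k_def)
    also have "\<dots> = 4 * (\<rho> + 2) / (e ^ 3 * (k * sqrt k))"
      using e k by (simp add: s field_simps)
    finally show ?thesis .
  qed
  have main: "\<bar>expectation (\<lambda>\<omega>. f c (\<Sum>j\<in>J. Y j \<omega>)) - (\<integral>z. f c z \<partial>normal_law 1)\<bar> \<le> err" for c
  proof -
    have "k * (4 * (\<rho> + 2) / (e ^ 3 * (k * sqrt k))) = err"
      using k e by (simp add: err_def k_def[symmetric] field_simps)
    then show ?thesis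
      using lindeberg_replacement[where x = 0 and f = "f c", OF J ind mf B s(1) one] s(4) by (simp add: k_def)
  qed
  have mS [measurable]: "(\<lambda>\<omega>. \<Sum>j\<in>J. Y j \<omega>) \<in> borel_measurable M" by measurable
  have q: "measure (normal_law 1) {v..} = G1.prob {z\<in>space (normal_law 1). v \<le> z}" for v
    by (auto intro!: arg_cong[where f = G1.prob])
  have hi: "f c x = 1" if "x \<ge> c + 3 * e" for c x
    using that e by (auto simp: f_def field_simps intro!: spline_1)
  have lo: "f c x = 0" if "x < c" for c x
    using that e by (auto simp: f_def field_simps intro!: spline_0)
  show "prob {\<omega>\<in>space M. u \<le> (\<Sum>j\<in>J. Y j \<omega>)} \<le> measure (normal_law 1) {u - 3 * e..} + err"
  proof -
    \<comment> \<open>For the upper bound the step starts at \<open>u - 3 * e\<close>, so that it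
      has reached 1 at \<open>u\<close>. For the lower bound it starts at \<open>u\<close>, so that
      it vanishes to the left of \<open>u\<close>.\<close>
    have "prob {\<omega>\<in>space M. u \<le> (\<Sum>j\<in>J. Y j \<omega>)} \<le> expectation (\<lambda>\<omega>. f (u - 3 * e) (\<Sum>j\<in>J. Y j \<omega>))"
      by (rule expectation_indicator_mono(1)[OF mS mf f01]) (auto intro: hi)
    moreover have "(\<integral>z. f (u - 3 * e) z \<partial>normal_law 1) \<le> measure (normal_law 1) {u - 3 * e..}"
      unfolding q by (rule G1.expectation_indicator_mono(2)[OF _ mf f01]) (auto intro: lo)
    ultimately show ?thesis using main[of "u - 3 * e"] by linarith
  qed
  show "measure (normal_law 1) {u + 3 * e..} - err \<le> prob {\<omega>\<in>space M. u \<le> (\<Sum>j\<in>J. Y j \<omega>)}"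
  proof -
    have "expectation (\<lambda>\<omega>. f u (\<Sum>j\<in>J. Y j \<omega>)) \<le> prob {\<omega>\<in>space M. u \<le> (\<Sum>j\<in>J. Y j \<omega>)}"
      by (rule expectation_indicator_mono(2)[OF mS mf f01]) (auto intro: lo)
    moreover have "measure (normal_law 1) {u + 3 * e..} \<le> (\<integral>z. f u z \<partial>normal_law 1)"
      unfolding q by (rule G1.expectation_indicator_mono(1)[OF _ mf f01]) (auto intro: hi)
    ultimately show ?thesis using main[of u] by linarith
  qed
qed

section \<open>Tails on the Gumbel scale\<close>

text \<open>The function -phi(x)/x is an antiderivative of phi(x) (1 + 1/x^2), where phi is the
  standard normal density. Hence the integral of the latter over [u, infinity) is exactly phi(u)/u,
  and the factor lies between 1 and 1 + 1/u^2 there.\<close>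

lemma mills_ratio_bounds:
  assumes u: "u > 0"
  shows "measure (normal_law 1) {u..} \<le> std_normal_density u / u"
    and "std_normal_density u / u \<le> (1 + 1 / u\<^sup>2) * measure (normal_law 1) {u..}"
proof -
  interpret prob_space "normal_law 1" by (rule prob_space_normal_law) simp
  let ?f = "\<lambda>x::real. std_normal_density x * (1 + 1 / x\<^sup>2)"
  define F where "F x = - (std_normal_density x / x)" for x :: real
  obtain K where K: "std_normal_density x = K * exp (- (x\<^sup>2 / 2))" for x
    using that[of "1 / sqrt (2 * pi)"] by (simp add: normal_density_def)
  have dF: "(F has_real_derivative ?f x) (at x)" if "u \<le> x" for x
  proof -
    have "x \<noteq> 0" using that u by auto
    then show ?thesis
      unfolding F_def[abs_def] K
      by (auto intro!: derivative_eq_intros simp: field_simps power2_eq_square)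
  qed
  have lim: "(F \<longlongrightarrow> 0) at_top"
    unfolding F_def[abs_def] normal_density_def by real_asymp
  have I: "(\<integral>\<^sup>+x. ennreal (?f x) * indicator {u..} x \<partial>lborel) = ennreal (std_normal_density u / u)"
    using nn_integral_FTC_atLeast[of ?f u F 0, OF _ dF _ lim] by (simp add: F_def normal_density_nonneg)
  have Q: "ennreal (measure (normal_law 1) {u..}) = (\<integral>\<^sup>+x. ennreal (std_normal_density x) * indicator {u..} x \<partial>lborel)"
    unfolding emeasure_eq_measure[symmetric] by (simp add: normal_law_def emeasure_density)
  have "ennreal (measure (normal_law 1) {u..}) \<le> ennreal (std_normal_density u / u)"
    unfolding I[symmetric] Q
    by (intro nn_integral_mono)
       (auto simp: indicator_def distrib_left normal_density_nonneg intro!: ennreal_leI)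
  then show "measure (normal_law 1) {u..} \<le> std_normal_density u / u"
    using u by (subst (asm) ennreal_le_iff) (auto simp: normal_density_nonneg)
  define C where "C = 1 + 1 / u\<^sup>2"
  have C: "C \<ge> 0" by (simp add: C_def)
  have "ennreal (std_normal_density u / u)
      \<le> (\<integral>\<^sup>+x. ennreal C * (ennreal (std_normal_density x) * indicator {u..} x) \<partial>lborel)"
    unfolding I[symmetric]
  proof (intro nn_integral_mono)
    fix x :: real
    show "ennreal (?f x) * indicator {u..} x \<le> ennreal C * (ennreal (std_normal_density x) * indicator {u..} x)"
    proof (cases "x \<ge> u")
      case True
      then have "1 / x\<^sup>2 \<le> 1 / u\<^sup>2" using u by (intro divide_left_mono) (auto intro: power_mono)
      then have "?f x \<le> C * std_normal_density x"
        unfolding C_def by (subst mult.commute) (intro mult_right_mono, auto simp: normal_density_nonneg)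
      then show ?thesis using True by (simp add: C ennreal_mult[symmetric] normal_density_nonneg ennreal_leI)
    qed simp
  qed
  also have "\<dots> = ennreal (C * measure (normal_law 1) {u..})"
    by (subst nn_integral_cmult) (auto simp: Q[symmetric] ennreal_mult C)
  finally show "std_normal_density u / u \<le> (1 + 1 / u\<^sup>2) * measure (normal_law 1) {u..}"
    using C by (subst (asm) ennreal_le_iff) (auto simp: C_def)
qed

section \<open>Normal tails at Gumbel levels\<close>

lemma a_norm_at_top: "filterlim n at_top F \<Longrightarrow> filterlim (\<lambda>d. a_norm (n d)) at_top F"
proof -
  have "filterlim (\<lambda>x::real. sqrt (2 * ln x)) at_top at_top" by real_asymp
  then have "filterlim a_norm at_top sequentially"
    unfolding a_norm_def[abs_def] by (rule filterlim_compose) (rule filterlim_real_sequentially)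
  then show "filterlim n at_top F \<Longrightarrow> filterlim (\<lambda>d. a_norm (n d)) at_top F"
    by (rule filterlim_compose)
qed

text \<open>Since a_norm^2 = 2 ln m, the logarithm of \<open>a_norm m\<close> absorbs ln (ln m) and
  a factor 2, which turns \<open>4 * pi\<close> into \<open>2 * pi\<close>. With
  \<open>b_norm\<close> written through \<open>a_norm\<close> alone, limits can be taken in one real
  variable. The condition \<open>m \<ge> 2\<close> keeps ln m positive.\<close>

lemma b_norm_eq:
  assumes "m \<ge> 2"
  shows "b_norm m = a_norm m - (ln (sqrt (2 * pi)) + ln (a_norm m)) / a_norm m"
proof -
  have "ln (real m) > 0" using assms by simp
  then have e: "ln (sqrt (2 * pi)) + ln (a_norm m) = (ln (ln (real m)) + ln (4 * pi)) / 2"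
    by (simp add: a_norm_def ln_sqrt ln_mult field_simps)
       (use ln_mult[of 2 2] in simp)
  show ?thesis unfolding b_norm_def e by (simp add: a_norm_def)
qed

text \<open>By the Mills ratio the tail may be replaced by phi(u)/u. Write u = a + r with r = (w -
  c)/a, which tends to 0, and n = exp(a^2/2). Then a^2/2 - u^2/2 = c - w - r^2/2, and exp c = sqrt(2
  pi) a cancels both the normalization of the density and the leading part of the divisor u. This
  cancellation is what the correction term in \<open>b_norm\<close> is made for.\<close>

lemma gumbel_scale_normal_tail:
  assumes n: "filterlim n at_top F"
    and u: "((\<lambda>d. a_norm (n d) * (u d - b_norm (n d))) \<longlongrightarrow> x) F"
  shows "((\<lambda>d. real (n d) * measure (normal_law 1) {u d..}) \<longlongrightarrow> exp (- x)) F"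
proof -
  define a where "a d = a_norm (n d)" for d
  define w where "w d = a d * (u d - b_norm (n d))" for d
  define c where "c d = ln (sqrt (2 * pi)) + ln (a d)" for d
  define r where "r d = (w d - c d) / a d" for d
  have a: "filterlim a at_top F" unfolding a_def by (rule a_norm_at_top) fact
  have w: "(w \<longlongrightarrow> x) F" using u by (simp add: w_def[abs_def] a_def)
  have ev: "\<forall>\<^sub>F d in F. n d \<ge> 2 \<and> a d > 0"
    using n[unfolded filterlim_at_top] a[unfolded filterlim_at_top_dense] by (simp add: eventually_conj_iff)
  have ueq: "\<forall>\<^sub>F d in F. u d = a d + r d"
    using ev
  proof eventually_elim
    case (elim d)
    then have "b_norm (n d) = a d - c d / a d" using b_norm_eq[of "n d"] by (simp add: a_def c_def)
    then show ?case using elim by (simp add: w_def r_def field_simps)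
  qed
  have "((\<lambda>y::real. (ln (sqrt (2 * pi)) + ln y) / y) \<longlongrightarrow> 0) at_top" by real_asymp
  then have "((\<lambda>d. c d / a d) \<longlongrightarrow> 0) F"
    unfolding c_def by (rule filterlim_compose) (rule a)
  moreover have "((\<lambda>d. w d / a d) \<longlongrightarrow> 0) F"
    by (rule real_tendsto_divide_at_top[OF w a])
  ultimately have r: "(r \<longlongrightarrow> 0) F"
    unfolding r_def[abs_def] using tendsto_diff by (fastforce simp: diff_divide_distrib)
  have ra: "((\<lambda>d. r d / a d) \<longlongrightarrow> 0) F"
    by (rule real_tendsto_divide_at_top[OF r a])
  have utop: "filterlim u at_top F"
    using filterlim_tendsto_add_at_top[OF r a] ueq
    by (subst filterlim_cong[OF refl refl, where g = "\<lambda>d. r d + a d"]) (auto elim: eventually_mono)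
  have den: "\<forall>\<^sub>F d in F. real (n d) * (std_normal_density (u d) / u d)
      = exp (- w d) * exp (- (r d)\<^sup>2 / 2) / (1 + r d / a d)"
    using ev ueq
  proof eventually_elim
    case (elim d)
    have nn: "real (n d) = exp ((a d)\<^sup>2 / 2)"
      using elim by (simp add: a_def a_norm_def)
    have rr: "r d * a d = w d - c d" using elim by (simp add: r_def)
    have ec: "exp (c d) = sqrt (2 * pi) * a d"
      using elim by (simp add: c_def exp_add)
    have "(a d)\<^sup>2 / 2 - (u d)\<^sup>2 / 2 = c d + (- w d + - (r d)\<^sup>2 / 2)"
      using elim rr by (simp add: power2_eq_square algebra_simps add_divide_distrib)
    then have "exp ((a d)\<^sup>2 / 2) * exp (- ((u d)\<^sup>2 / 2)) = exp (c d) * (exp (- w d) * exp (- (r d)\<^sup>2 / 2))"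
      by (simp add: mult_exp_exp)
    then have "real (n d) * (std_normal_density (u d) / u d)
        = (sqrt (2 * pi) * a d) * (exp (- w d) * exp (- (r d)\<^sup>2 / 2)) / (sqrt (2 * pi) * u d)"
      unfolding normal_density_def nn ec by (simp add: field_simps)
    also have "\<dots> = (sqrt (2 * pi) * a d) * (exp (- w d) * exp (- (r d)\<^sup>2 / 2)) / (sqrt (2 * pi) * (a d * (1 + r d / a d)))"
      using elim by (simp add: distrib_left)
    finally show ?case using elim by simp
  qed
  have "((\<lambda>d. exp (- w d) * exp (- (r d)\<^sup>2 / 2) / (1 + r d / a d)) \<longlongrightarrow> exp (- x) * exp (- 0\<^sup>2 / 2) / (1 + 0)) F"
    by (intro tendsto_intros w r ra) auto
  then have lim: "((\<lambda>d. real (n d) * (std_normal_density (u d) / u d)) \<longlongrightarrow> exp (- x)) F"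
    using den by (subst tendsto_cong[OF den]) simp
  have "((\<lambda>d. 1 + 1 / (u d)\<^sup>2) \<longlongrightarrow> 1 + 0) F"
    by (intro tendsto_intros real_tendsto_divide_at_top[OF tendsto_const] filterlim_pow_at_top utop) auto
  then have lim': "((\<lambda>d. real (n d) * (std_normal_density (u d) / u d) / (1 + 1 / (u d)\<^sup>2)) \<longlongrightarrow> exp (- x)) F"
    using tendsto_divide[OF lim] by force
  have u0: "\<forall>\<^sub>F d in F. u d > 0" using utop by (simp add: filterlim_at_top_dense)
  show ?thesis
  proof (rule tendsto_sandwich[OF _ _ lim' lim])
    show "\<forall>\<^sub>F d in F. real (n d) * (std_normal_density (u d) / u d) / (1 + 1 / (u d)\<^sup>2)
        \<le> real (n d) * measure (normal_law 1) {u d..}"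
      using u0
    proof eventually_elim
      case (elim d)
      have "1 + 1 / (u d)\<^sup>2 > 0" by (simp add: add_pos_nonneg)
      then have "std_normal_density (u d) / u d / (1 + 1 / (u d)\<^sup>2) \<le> measure (normal_law 1) {u d..}"
        using mills_ratio_bounds(2)[OF elim] by (subst pos_divide_le_eq) (auto simp: mult.commute)
      then have "real (n d) * (std_normal_density (u d) / u d / (1 + 1 / (u d)\<^sup>2)) \<le> real (n d) * measure (normal_law 1) {u d..}"
        by (rule mult_left_mono) simp
      then show ?case by simp
    qed
    show "\<forall>\<^sub>F d in F. real (n d) * measure (normal_law 1) {u d..} \<le> real (n d) * (std_normal_density (u d) / u d)"
      using u0 by eventually_elim (intro mult_left_mono mills_ratio_bounds; simp)
  qed
qed

text \<open>A squeeze with two limits: first \<open>d\<close> goes to its limit for fixed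
  \<open>\<eta>\<close>, then \<open>\<eta>\<close> tends to 0 from the right. It serves smoothing,
  the change from weak to strict inequalities, and the passage to sums of two variables.\<close>

lemma tendsto_sandwich_approx:
  fixes g :: "'b \<Rightarrow> real" and L H :: "real \<Rightarrow> real"
  assumes l: "\<And>\<eta>. \<eta> > 0 \<Longrightarrow> \<exists>l l'. (\<forall>\<^sub>F d in F. l d \<le> g d) \<and> (l \<longlongrightarrow> l') F \<and> L \<eta> \<le> l'"
      "(L \<longlongrightarrow> c) (at_right 0)"
    and h: "\<And>\<eta>. \<eta> > 0 \<Longrightarrow> \<exists>h h'. (\<forall>\<^sub>F d in F. g d \<le> h d) \<and> (h \<longlongrightarrow> h') F \<and> h' \<le> H \<eta>"
      "(H \<longlongrightarrow> c) (at_right 0)"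
  shows "(g \<longlongrightarrow> c) F"
proof (rule order_tendstoI)
  have pos: "\<forall>\<^sub>F \<eta> in at_right (0::real). \<eta> > 0" by (simp add: eventually_at_right_less)
  fix y assume "y < c"
  then have "\<forall>\<^sub>F \<eta> in at_right 0. y < L \<eta> \<and> \<eta> > 0"
    by (intro eventually_conj order_tendstoD(1)[OF l(2)] pos)
  then obtain \<eta> where "y < L \<eta>" "\<eta> > 0"
    using eventually_happens' by (metis (no_types, lifting) trivial_limit_at_right_real)
  with l(1) obtain f f' where f: "\<forall>\<^sub>F d in F. f d \<le> g d" "(f \<longlongrightarrow> f') F" "y < f'"
    by (meson order_less_le_trans)
  show "\<forall>\<^sub>F d in F. y < g d" using order_tendstoD(1)[OF f(2,3)] f(1) by eventually_elim simp
next
  have pos: "\<forall>\<^sub>F \<eta> in at_right (0::real). \<eta> > 0" by (simp add: eventually_at_right_less)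
  fix y assume "c < y"
  then have "\<forall>\<^sub>F \<eta> in at_right 0. H \<eta> < y \<and> \<eta> > 0"
    by (intro eventually_conj order_tendstoD(2)[OF h(2)] pos)
  then obtain \<eta> where "H \<eta> < y" "\<eta> > 0"
    using eventually_happens' by (metis (no_types, lifting) trivial_limit_at_right_real)
  with h(1) obtain f f' where f: "\<forall>\<^sub>F d in F. g d \<le> f d" "(f \<longlongrightarrow> f') F" "f' < y"
    by (meson order_le_less_trans)
  show "\<forall>\<^sub>F d in F. g d < y" using order_tendstoD(2)[OF f(2,3)] f(1) by eventually_elim simp
qed

text \<open>For fixed \<open>\<eta>\<close> the two bounding normal tails, multiplied by n, tend to
  exp(-(x + \<eta>)) and exp(-(x - \<eta>)), while n times the replacement error vanishes. The order
  of the limits matters, because that error carries the factor 1 / \<eta>^3.\<close>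

lemma gumbel_scale_sum_tail:
  fixes Y :: "nat \<Rightarrow> nat \<Rightarrow> 'a \<Rightarrow> real" and n :: "nat \<Rightarrow> nat"
  assumes n: "filterlim n at_top sequentially"
    and rate: "(\<lambda>d. real (n d) * a_norm (n d) ^ 3 / sqrt d) \<longlonglongrightarrow> 0"
    and M: "\<And>d. d \<ge> 1 \<Longrightarrow> prob_space (M d)"
    and ind: "\<And>d. d \<ge> 1 \<Longrightarrow> prob_space.indep_vars (M d) (\<lambda>_. borel) (Y d) {1..d}"
    and int3: "\<And>d j. d \<ge> 1 \<Longrightarrow> j \<in> {1..d} \<Longrightarrow> integrable (M d) (\<lambda>\<omega>. \<bar>Y d j \<omega>\<bar> ^ 3)"
    and mean: "\<And>d j. d \<ge> 1 \<Longrightarrow> j \<in> {1..d} \<Longrightarrow> (\<integral>\<omega>. Y d j \<omega> \<partial>M d) = 0"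
    and var: "\<And>d j. d \<ge> 1 \<Longrightarrow> j \<in> {1..d} \<Longrightarrow> (\<integral>\<omega>. Y d j \<omega> ^ 2 \<partial>M d) = 1 / d"
    and third: "\<And>d j. d \<ge> 1 \<Longrightarrow> j \<in> {1..d} \<Longrightarrow> (\<integral>\<omega>. \<bar>Y d j \<omega>\<bar> ^ 3 \<partial>M d) \<le> \<rho> / (d * sqrt d)"
    and u: "(\<lambda>d. a_norm (n d) * (u d - b_norm (n d))) \<longlonglongrightarrow> x"
  shows "(\<lambda>d. real (n d) * measure (M d) {\<omega>\<in>space (M d). u d \<le> (\<Sum>j=1..d. Y d j \<omega>)}) \<longlonglongrightarrow> exp (- x)"
proof -
  define a where "a d = a_norm (n d)" for d
  have a: "filterlim a at_top sequentially" unfolding a_def by (rule a_norm_at_top) fact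
  have ev: "\<forall>\<^sub>F d in sequentially. d \<ge> 1 \<and> a d > 0"
    using a eventually_ge_at_top[of 1] by (auto simp: filterlim_at_top_dense eventually_conj_iff)
  define Q where "Q v = measure (normal_law 1) {v..}" for v
  define err where "err \<eta> d = 4 * (\<rho> + 2) * 27 / \<eta> ^ 3 * (real (n d) * a d ^ 3 / sqrt d)" for \<eta> d
  have err: "err \<eta> \<longlonglongrightarrow> 0" for \<eta>
    unfolding err_def a_def by (rule tendsto_mult_right_zero[OF rate])
  have shift: "(\<lambda>d. real (n d) * Q (u d + t / a d)) \<longlonglongrightarrow> exp (- (x + t))" for t
    unfolding Q_def
  proof (rule gumbel_scale_normal_tail[OF n])
    have "(\<lambda>d. a_norm (n d) * (u d - b_norm (n d)) + t) \<longlonglongrightarrow> x + t"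
      by (intro tendsto_intros u)
    moreover have "\<forall>\<^sub>F d in sequentially. a_norm (n d) * (u d - b_norm (n d)) + t
        = a_norm (n d) * (u d + t / a d - b_norm (n d))"
      using ev by eventually_elim (simp add: a_def field_simps)
    ultimately show "(\<lambda>d. a_norm (n d) * (u d + t / a d - b_norm (n d))) \<longlonglongrightarrow> x + t"
      by (rule Lim_transform_eventually)
  qed
  let ?p = "\<lambda>d. measure (M d) {\<omega>\<in>space (M d). u d \<le> (\<Sum>j=1..d. Y d j \<omega>)}"
  have bound: "\<forall>\<^sub>F d in sequentially. real (n d) * Q (u d + \<eta> / a d) - err \<eta> d \<le> real (n d) * ?p d
     \<and> real (n d) * ?p d \<le> real (n d) * Q (u d + (- \<eta>) / a d) + err \<eta> d" if \<eta>: "\<eta> > 0" for \<eta>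
    using ev
  proof eventually_elim
    case (elim d)
    interpret prob_space "M d" using M elim by simp
    \<comment> \<open>The stretched spline then rises over a length
      \<open>3 * ?e = \<eta> / a d\<close>, which is a displacement by \<open>\<eta>\<close> on the
      Gumbel scale. The cube of the 3 is the 27 in \<open>err\<close>.\<close>
    let ?e = "\<eta> / (3 * a d)"
    have "?e > 0" using \<eta> elim by simp
    note st = sum_tail_normal[of "{1..d}" "Y d" \<rho> ?e "u d"]
    define E where "E = 4 * (\<rho> + 2) / (?e ^ 3 * sqrt d)"
    have e: "real (n d) * E = err \<eta> d"
      using elim \<eta> by (simp add: err_def E_def field_simps power_divide)
    have "Q (u d + \<eta> / a d) - E \<le> ?p d"
      "?p d \<le> Q (u d + (- \<eta>) / a d) + E"
      using st \<open>?e > 0\<close> elim ind int3 mean var third by (auto simp: Q_def E_def)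
    then have "real (n d) * (Q (u d + \<eta> / a d) - E) \<le> real (n d) * ?p d"
      "real (n d) * ?p d \<le> real (n d) * (Q (u d + (- \<eta>) / a d) + E)"
      by (intro mult_left_mono; simp)+
    then show ?case by (simp only: right_diff_distrib distrib_left e)
  qed
  show ?thesis
  proof (rule tendsto_sandwich_approx)
    fix \<eta> :: real assume "\<eta> > 0"
    have "\<forall>\<^sub>F d in sequentially. real (n d) * Q (u d + \<eta> / a d) - err \<eta> d \<le> real (n d) * ?p d"
      using bound[OF \<open>\<eta> > 0\<close>] by eventually_elim auto
    moreover have "(\<lambda>d. real (n d) * Q (u d + \<eta> / a d) - err \<eta> d) \<longlonglongrightarrow> exp (- (x + \<eta>)) - 0"
      by (intro tendsto_diff shift err)
    ultimately show "\<exists>l l'. (\<forall>\<^sub>F d in sequentially. l d \<le> real (n d) * ?p d) \<and> l \<longlonglongrightarrow> l' \<and> exp (- (x + \<eta>)) \<le> l'"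
      by fastforce
    have "\<forall>\<^sub>F d in sequentially. real (n d) * ?p d \<le> real (n d) * Q (u d + (- \<eta>) / a d) + err \<eta> d"
      using bound[OF \<open>\<eta> > 0\<close>] by eventually_elim auto
    moreover have "(\<lambda>d. real (n d) * Q (u d + (- \<eta>) / a d) + err \<eta> d) \<longlonglongrightarrow> exp (- (x + - \<eta>)) + 0"
      by (intro tendsto_add shift err)
    ultimately show "\<exists>h h'. (\<forall>\<^sub>F d in sequentially. real (n d) * ?p d \<le> h d) \<and> h \<longlonglongrightarrow> h' \<and> h' \<le> exp (- (x + - \<eta>))"
      by fastforce
  qed (auto intro!: tendsto_eq_intros)
qed

text \<open>The sums may have atoms, so strict and weak tails can differ for each \<open>d\<close>.
  The strict tail at \<open>u d\<close> is squeezed between the weak tails at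
  \<open>u d + \<eta> / a d\<close> and at \<open>u d\<close>. The strict form is the one
  complementary to an event of the form "at most".\<close>

lemma gumbel_scale_sum_tail_strict:
  fixes Y :: "nat \<Rightarrow> nat \<Rightarrow> 'a \<Rightarrow> real" and n :: "nat \<Rightarrow> nat"
  assumes n: "filterlim n at_top sequentially"
    and rate: "(\<lambda>d. real (n d) * a_norm (n d) ^ 3 / sqrt d) \<longlonglongrightarrow> 0"
    and M: "\<And>d. d \<ge> 1 \<Longrightarrow> prob_space (M d)"
    and ind: "\<And>d. d \<ge> 1 \<Longrightarrow> prob_space.indep_vars (M d) (\<lambda>_. borel) (Y d) {1..d}"
    and int3: "\<And>d j. d \<ge> 1 \<Longrightarrow> j \<in> {1..d} \<Longrightarrow> integrable (M d) (\<lambda>\<omega>. \<bar>Y d j \<omega>\<bar> ^ 3)"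
    and mean: "\<And>d j. d \<ge> 1 \<Longrightarrow> j \<in> {1..d} \<Longrightarrow> (\<integral>\<omega>. Y d j \<omega> \<partial>M d) = 0"
    and var: "\<And>d j. d \<ge> 1 \<Longrightarrow> j \<in> {1..d} \<Longrightarrow> (\<integral>\<omega>. Y d j \<omega> ^ 2 \<partial>M d) = 1 / d"
    and third: "\<And>d j. d \<ge> 1 \<Longrightarrow> j \<in> {1..d} \<Longrightarrow> (\<integral>\<omega>. \<bar>Y d j \<omega>\<bar> ^ 3 \<partial>M d) \<le> \<rho> / (d * sqrt d)"
    and u: "(\<lambda>d. a_norm (n d) * (u d - b_norm (n d))) \<longlonglongrightarrow> x"
  shows "(\<lambda>d. real (n d) * measure (M d) {\<omega>\<in>space (M d). u d < (\<Sum>j=1..d. Y d j \<omega>)}) \<longlonglongrightarrow> exp (- x)"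
proof -
  define a where "a d = a_norm (n d)" for d
  have a: "filterlim a at_top sequentially" unfolding a_def by (rule a_norm_at_top) fact
  have ev: "\<forall>\<^sub>F d in sequentially. d \<ge> 1 \<and> a d > 0"
    using a eventually_ge_at_top[of 1] by (auto simp: filterlim_at_top_dense eventually_conj_iff)
  note tail = gumbel_scale_sum_tail[OF n rate M ind int3 mean var third]
  have shift: "(\<lambda>d. real (n d) * measure (M d) {\<omega>\<in>space (M d). u d + t / a d \<le> (\<Sum>j=1..d. Y d j \<omega>)})
     \<longlonglongrightarrow> exp (- (x + t))" for t
  proof (rule tail)
    have "(\<lambda>d. a_norm (n d) * (u d - b_norm (n d)) + t) \<longlonglongrightarrow> x + t"
      by (intro tendsto_intros u)
    moreover have "\<forall>\<^sub>F d in sequentially. a_norm (n d) * (u d - b_norm (n d)) + t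
        = a_norm (n d) * (u d + t / a d - b_norm (n d))"
      using ev by eventually_elim (simp add: a_def field_simps)
    ultimately show "(\<lambda>d. a_norm (n d) * (u d + t / a d - b_norm (n d))) \<longlonglongrightarrow> x + t"
      by (rule Lim_transform_eventually)
  qed
  have mono: "measure (M d) {\<omega>\<in>space (M d). P (\<Sum>j=1..d. Y d j \<omega>)} \<le> measure (M d) {\<omega>\<in>space (M d). R (\<Sum>j=1..d. Y d j \<omega>)}"
    if "d \<ge> 1" and [measurable]: "Measurable.pred borel R" and "\<And>s. P s \<Longrightarrow> R s" for d P R
  proof -
    interpret prob_space "M d" using M that by simp
    have [measurable]: "Y d j \<in> borel_measurable (M d)" if "j \<in> {1..d}" for j
      using ind[OF \<open>d \<ge> 1\<close>] that by (auto simp: indep_vars_def)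
    have "{\<omega>\<in>space (M d). R (\<Sum>j=1..d. Y d j \<omega>)} \<in> sets (M d)" by measurable
    then show ?thesis
      by (rule finite_measure_mono[rotated]) (use that in auto)
  qed
  let ?p = "\<lambda>d. measure (M d) {\<omega>\<in>space (M d). u d < (\<Sum>j=1..d. Y d j \<omega>)}"
  show ?thesis
  proof (rule tendsto_sandwich_approx)
    fix \<eta> :: real assume "\<eta> > 0"
    have "\<forall>\<^sub>F d in sequentially. real (n d) * measure (M d) {\<omega>\<in>space (M d). u d + \<eta> / a d \<le> (\<Sum>j=1..d. Y d j \<omega>)}
        \<le> real (n d) * ?p d"
      using ev
    proof eventually_elim
      case (elim d)
      then have "\<eta> / a d > 0" using \<open>\<eta> > 0\<close> by simp
      then show ?case using elim by (intro mult_left_mono mono) auto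
    qed
    then show "\<exists>l l'. (\<forall>\<^sub>F d in sequentially. l d \<le> real (n d) * ?p d) \<and> l \<longlonglongrightarrow> l' \<and> exp (- (x + \<eta>)) \<le> l'"
      using shift[of \<eta>] by fastforce
    have "\<forall>\<^sub>F d in sequentially. real (n d) * ?p d
        \<le> real (n d) * measure (M d) {\<omega>\<in>space (M d). u d + 0 / a d \<le> (\<Sum>j=1..d. Y d j \<omega>)}"
      using ev by eventually_elim (intro mult_left_mono mono; simp)
    then show "\<exists>h h'. (\<forall>\<^sub>F d in sequentially. real (n d) * ?p d \<le> h d) \<and> h \<longlonglongrightarrow> h' \<and> h' \<le> exp (- x)"
      using shift[of 0] by fastforce
  qed (auto intro!: tendsto_eq_intros)
qed

section \<open>Convergence of a sum from joint distribution functions\<close>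

text \<open>Each difference of \<open>F\<close> is the mass of a half-strip t_i < U <= t_(i+1), V <=
  y, and these strips are disjoint. Inside strip i, V <= z - t_(i+1) forces U + V <= z, which gives
  the lower bound, and U + V <= z forces V <= z - t_i, which gives the upper one. The term with the
  arbitrary cutoff \<open>k\<close> pays for points not covered by the strips.\<close>

lemma (in prob_space) joint_cdf_staircase:
  fixes U V :: "'a \<Rightarrow> real" and t :: "nat \<Rightarrow> real"
  assumes [measurable]: "U \<in> borel_measurable M" "V \<in> borel_measurable M" and t: "incseq t"
  defines "F \<equiv> \<lambda>x y. prob {\<omega>\<in>space M. U \<omega> \<le> x \<and> V \<omega> \<le> y}"
  shows "(\<Sum>i<m. F (t (Suc i)) (z - t (Suc i)) - F (t i) (z - t (Suc i))) \<le> prob {\<omega>\<in>space M. U \<omega> + V \<omega> \<le> z}"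
    and "prob {\<omega>\<in>space M. U \<omega> + V \<omega> \<le> z} \<le> 1 - (F (t m) k - F (t 0) k)
           + (\<Sum>i<m. F (t (Suc i)) (z - t i) - F (t i) (z - t i))"
    and "y \<le> y' \<Longrightarrow> F (t (Suc i)) y - F (t i) y \<le> F (t (Suc i)) y' - F (t i) y'"
proof -
  have strip: "F x' y - F x y = prob {\<omega>\<in>space M. x < U \<omega> \<and> U \<omega> \<le> x' \<and> V \<omega> \<le> y}" if "x \<le> x'" for x x' y
  proof -
    have "F x' y - F x y = prob ({\<omega>\<in>space M. U \<omega> \<le> x' \<and> V \<omega> \<le> y} - {\<omega>\<in>space M. U \<omega> \<le> x \<and> V \<omega> \<le> y})"
      unfolding F_def by (rule finite_measure_Diff[symmetric]) (use that in auto)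
    also have "\<dots> = prob {\<omega>\<in>space M. x < U \<omega> \<and> U \<omega> \<le> x' \<and> V \<omega> \<le> y}"
      by (rule arg_cong[where f = prob]) (use that in auto)
    finally show ?thesis .
  qed
  have tS: "t i \<le> t (Suc i)" for i using t by (simp add: incseq_SucD)
  show "F (t (Suc i)) y - F (t i) y \<le> F (t (Suc i)) y' - F (t i) y'" if "y \<le> y'"
    unfolding strip[OF tS] by (rule finite_measure_mono) (use that in auto)
  have uniq: "i = j" if "t i < s" "s \<le> t (Suc i)" "t j < s" "s \<le> t (Suc j)" for i j s
  proof -
    have "\<not> Suc i \<le> j" "\<not> Suc j \<le> i" using that incseqD[OF t, of "Suc i" j] incseqD[OF t, of "Suc j" i] by auto
    then show ?thesis by simp
  qed
  let ?A = "\<lambda>i y. {\<omega>\<in>space M. t i < U \<omega> \<and> U \<omega> \<le> t (Suc i) \<and> V \<omega> \<le> y}"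
  have "(\<Sum>i<m. F (t (Suc i)) (z - t (Suc i)) - F (t i) (z - t (Suc i))) = (\<Sum>i<m. prob (?A i (z - t (Suc i))))"
    by (simp add: strip[OF tS])
  also have "\<dots> = prob (\<Union>i<m. ?A i (z - t (Suc i)))"
  proof (rule finite_measure_finite_Union[symmetric])
    show "disjoint_family_on (\<lambda>i. ?A i (z - t (Suc i))) {..<m}"
      using uniq by (fastforce simp: disjoint_family_on_def)
  qed auto
  also have "\<dots> \<le> prob {\<omega>\<in>space M. U \<omega> + V \<omega> \<le> z}"
    by (rule finite_measure_mono) auto
  finally show "(\<Sum>i<m. F (t (Suc i)) (z - t (Suc i)) - F (t i) (z - t (Suc i))) \<le> prob {\<omega>\<in>space M. U \<omega> + V \<omega> \<le> z}" .
  let ?K = "{\<omega>\<in>space M. t 0 < U \<omega> \<and> U \<omega> \<le> t m \<and> V \<omega> \<le> k}"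
  have find: "\<exists>i<m. t i < s \<and> s \<le> t (Suc i)" if "t 0 < s" "s \<le> t m" for s
    using that by (induction m) (auto, metis less_Suc_eq not_le)
  have "prob {\<omega>\<in>space M. U \<omega> + V \<omega> \<le> z} \<le> prob ((space M - ?K) \<union> (\<Union>i<m. ?A i (z - t i)))"
  proof (rule finite_measure_mono)
    show "{\<omega>\<in>space M. U \<omega> + V \<omega> \<le> z} \<subseteq> (space M - ?K) \<union> (\<Union>i<m. ?A i (z - t i))"
    proof
      fix \<omega> assume \<omega>: "\<omega> \<in> {\<omega>\<in>space M. U \<omega> + V \<omega> \<le> z}"
      show "\<omega> \<in> (space M - ?K) \<union> (\<Union>i<m. ?A i (z - t i))"
      proof (cases "\<omega> \<in> ?K")
        case True
        then obtain i where "i < m" "t i < U \<omega>" "U \<omega> \<le> t (Suc i)" using find by blast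
        moreover from this \<omega> have "V \<omega> \<le> z - t i" by auto
        ultimately show ?thesis using \<omega> by auto
      qed (use \<omega> in auto)
    qed
  qed auto
  also have "\<dots> \<le> prob (space M - ?K) + prob (\<Union>i<m. ?A i (z - t i))"
    by (rule measure_Un_le) auto
  also have "\<dots> \<le> (1 - prob ?K) + (\<Sum>i<m. prob (?A i (z - t i)))"
    by (intro add_mono finite_measure_subadditive_finite) (auto simp: prob_compl)
  also have "prob ?K = F (t m) k - F (t 0) k"
    using incseqD[OF t, of 0 m] by (simp add: strip)
  finally show "prob {\<omega>\<in>space M. U \<omega> + V \<omega> \<le> z} \<le> 1 - (F (t m) k - F (t 0) k)
           + (\<Sum>i<m. F (t (Suc i)) (z - t i) - F (t i) (z - t i))"
    by (simp add: strip[OF tS])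
qed

text \<open>For a fixed finite grid both staircase bounds are finite combinations of joint
  distribution functions, so they converge. On an equally spaced grid the limiting bounds at
  \<open>z\<close> are staircases of the limit pair at \<open>z - \<eta>\<close> and
  \<open>z + \<eta>\<close>. Tightness of the limit pair and continuity of its distribution function
  at \<open>z\<close> close the gap as \<open>\<eta>\<close> tends to 0.\<close>

lemma weak_conv_sum_of_joint_cdf:
  fixes U V :: "nat \<Rightarrow> 'a \<Rightarrow> real" and E E' :: "'c \<Rightarrow> real"
  assumes M: "\<And>d. d \<ge> 1 \<Longrightarrow> prob_space (M d)"
    and UV: "\<And>d. d \<ge> 1 \<Longrightarrow> U d \<in> borel_measurable (M d)" "\<And>d. d \<ge> 1 \<Longrightarrow> V d \<in> borel_measurable (M d)"
    and P: "prob_space P" and E [measurable]: "E \<in> borel_measurable P" "E' \<in> borel_measurable P"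
    and joint: "\<And>x y. (\<lambda>d. measure (M d) {\<omega>\<in>space (M d). U d \<omega> \<le> x \<and> V d \<omega> \<le> y})
        \<longlonglongrightarrow> measure P {\<omega>\<in>space P. E \<omega> \<le> x \<and> E' \<omega> \<le> y}"
  shows "weak_conv_m (\<lambda>d. distr (M d) borel (\<lambda>\<omega>. U d \<omega> + V d \<omega>)) (distr P borel (\<lambda>\<omega>. E \<omega> + E' \<omega>))"
  unfolding weak_conv_m_def weak_conv_def
proof (intro allI impI)
  interpret P: prob_space P by fact
  define c where "c z = P.prob {\<omega>\<in>space P. E \<omega> + E' \<omega> \<le> z}" for z
  have cdfP: "cdf (distr P borel (\<lambda>\<omega>. E \<omega> + E' \<omega>)) = c"
    by (auto simp: cdf_def c_def fun_eq_iff measure_distr intro!: arg_cong[where f = P.prob])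
  fix z assume "isCont (cdf (distr P borel (\<lambda>\<omega>. E \<omega> + E' \<omega>))) z"
  then have cont: "isCont c z" by (simp add: cdfP)
  have lims: "((\<lambda>\<eta>. c (z - \<eta>) - \<eta>) \<longlongrightarrow> c z - 0) (at_right 0)" "((\<lambda>\<eta>. c (z + \<eta>) + \<eta>) \<longlongrightarrow> c z + 0) (at_right 0)"
    by (intro tendsto_diff tendsto_add isCont_tendsto_compose[OF cont]; auto intro!: tendsto_eq_intros)+
  define F where "F d x y = measure (M d) {\<omega>\<in>space (M d). U d \<omega> \<le> x \<and> V d \<omega> \<le> y}" for d x y
  define G where "G x y = P.prob {\<omega>\<in>space P. E \<omega> \<le> x \<and> E' \<omega> \<le> y}" for x y
  have FG: "(\<lambda>d. F d x y) \<longlonglongrightarrow> G x y" for x y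
    using joint by (simp add: F_def G_def)
  define g where "g d = measure (M d) {\<omega>\<in>space (M d). U d \<omega> + V d \<omega> \<le> z}" for d
  have grid: "\<exists>t m k. incseq t \<and> (\<forall>i. t (Suc i) = t i + \<eta>) \<and> 1 - (G (t m) k - G (t 0) k) \<le> \<eta>" if "\<eta> > 0" for \<eta>
  proof -
    \<comment> \<open>Tightness of the limit pair: these boxes grow to the whole space, so one of
      them misses mass less than \<open>\<eta>\<close>. The grid then runs from
      \<open>- real k * \<eta>\<close> in \<open>2 * k\<close> steps of length
      \<open>\<eta>\<close>, with cutoff \<open>real k * \<eta>\<close> for
      \<open>E'\<close>.\<close>
    let ?A = "\<lambda>k::nat. {\<omega>\<in>space P. - real k * \<eta> < E \<omega> \<and> E \<omega> \<le> real k * \<eta> \<and> E' \<omega> \<le> real k * \<eta>}"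
    have "(\<lambda>k. P.prob (?A k)) \<longlonglongrightarrow> P.prob (\<Union>k. ?A k)"
    proof (rule P.finite_Lim_measure_incseq)
      show "incseq ?A"
      proof (rule incseq_SucI, rule subsetI)
        fix k \<omega> assume "\<omega> \<in> ?A k"
        moreover have "real k * \<eta> \<le> real (Suc k) * \<eta>" "- real (Suc k) * \<eta> \<le> - real k * \<eta>"
          using that by (auto simp: algebra_simps)
        ultimately show "\<omega> \<in> ?A (Suc k)" by (simp only: mem_Collect_eq) (elim conjE, intro conjI TrueI; linarith)
      qed
    qed auto
    also have "(\<Union>k. ?A k) = space P"
    proof
      show "space P \<subseteq> (\<Union>k. ?A k)"
      proof
        fix \<omega> assume \<omega>: "\<omega> \<in> space P"
        obtain k :: nat where "(\<bar>E \<omega>\<bar> + \<bar>E' \<omega>\<bar>) / \<eta> < k" using reals_Archimedean2 by blast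
        then have "\<bar>E \<omega>\<bar> + \<bar>E' \<omega>\<bar> < k * \<eta>" using that by (simp add: field_simps)
        then have "\<omega> \<in> ?A k" using \<omega> by auto
        then show "\<omega> \<in> (\<Union>k. ?A k)" by blast
      qed
    qed auto
    finally have "(\<lambda>k. P.prob (?A k)) \<longlonglongrightarrow> 1" by (simp add: P.prob_space)
    then have "\<forall>\<^sub>F k in sequentially. 1 - \<eta> < P.prob (?A k)"
      by (rule order_tendstoD(1)) (use that in simp)
    then obtain k where k: "1 - \<eta> < P.prob (?A k)" by (auto simp: eventually_sequentially)
    have "P.prob (?A k) = P.prob ({\<omega>\<in>space P. E \<omega> \<le> real k * \<eta> \<and> E' \<omega> \<le> real k * \<eta>} -
        {\<omega>\<in>space P. E \<omega> \<le> - real k * \<eta> \<and> E' \<omega> \<le> real k * \<eta>})"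
      by (rule arg_cong[where f = P.prob]) auto
    also have "\<dots> = G (real k * \<eta>) (real k * \<eta>) - G (- real k * \<eta>) (real k * \<eta>)"
      unfolding G_def
    proof (rule P.finite_measure_Diff)
      have "- (real k * \<eta>) \<le> real k * \<eta>" using that by simp
      then show "{\<omega>\<in>space P. E \<omega> \<le> - real k * \<eta> \<and> E' \<omega> \<le> real k * \<eta>} \<subseteq> {\<omega>\<in>space P. E \<omega> \<le> real k * \<eta> \<and> E' \<omega> \<le> real k * \<eta>}"
        by auto
    qed auto
    finally have "1 - (G (real k * \<eta>) (real k * \<eta>) - G (- real k * \<eta>) (real k * \<eta>)) \<le> \<eta>" using k by simp
    then show ?thesis using that
      by (intro exI[of _ "\<lambda>i. - real k * \<eta> + real i * \<eta>"] exI[of _ "2 * k"] exI[of _ "real k * \<eta>"])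
         (auto simp: incseq_def algebra_simps mult_right_mono)
  qed
  have "g \<longlonglongrightarrow> c z"
  proof (rule tendsto_sandwich_approx)
    fix \<eta> :: real assume \<eta>: "\<eta> > 0"
    obtain t m k where t: "incseq t" "\<And>i. t (Suc i) = t i + \<eta>" and tk: "1 - (G (t m) k - G (t 0) k) \<le> \<eta>"
      using grid[OF \<eta>] by blast
    note sG = P.joint_cdf_staircase[OF E t(1), folded G_def, folded c_def]
    have sF: "(\<Sum>i<m. F d (t (Suc i)) (z - t (Suc i)) - F d (t i) (z - t (Suc i))) \<le> g d"
      "g d \<le> 1 - (F d (t m) k - F d (t 0) k) + (\<Sum>i<m. F d (t (Suc i)) (z - t i) - F d (t i) (z - t i))"
      if "d \<ge> 1" for d
      unfolding F_def g_def by (rule prob_space.joint_cdf_staircase[OF M UV t(1)]; fact)+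
    show "\<exists>l l'. (\<forall>\<^sub>F d in sequentially. l d \<le> g d) \<and> l \<longlonglongrightarrow> l' \<and> c (z - \<eta>) - \<eta> \<le> l'"
    proof (intro exI conjI)
      show "\<forall>\<^sub>F d in sequentially. (\<Sum>i<m. F d (t (Suc i)) (z - t (Suc i)) - F d (t i) (z - t (Suc i))) \<le> g d"
        using eventually_ge_at_top[of 1] by eventually_elim (rule sF)
      show "(\<lambda>d. \<Sum>i<m. F d (t (Suc i)) (z - t (Suc i)) - F d (t i) (z - t (Suc i)))
          \<longlonglongrightarrow> (\<Sum>i<m. G (t (Suc i)) (z - t (Suc i)) - G (t i) (z - t (Suc i)))"
        by (intro tendsto_intros FG)
      \<comment> \<open>Because \<open>t (Suc i) = t i + \<eta>\<close>, the upper staircase of the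
        limit pair at level \<open>z - \<eta>\<close> is the lower staircase at level
        \<open>z\<close>.\<close>
      have "(\<Sum>i<m. G (t (Suc i)) (z - \<eta> - t i) - G (t i) (z - \<eta> - t i))
          = (\<Sum>i<m. G (t (Suc i)) (z - t (Suc i)) - G (t i) (z - t (Suc i)))"
        by (simp add: t(2) algebra_simps)
      then show "c (z - \<eta>) - \<eta> \<le> (\<Sum>i<m. G (t (Suc i)) (z - t (Suc i)) - G (t i) (z - t (Suc i)))"
        using sG(2)[of "z - \<eta>" m k] tk by linarith
    qed
    show "\<exists>h h'. (\<forall>\<^sub>F d in sequentially. g d \<le> h d) \<and> h \<longlonglongrightarrow> h' \<and> h' \<le> c (z + \<eta>) + \<eta>"
    proof (intro exI conjI)
      show "\<forall>\<^sub>F d in sequentially. g d \<le> 1 - (F d (t m) k - F d (t 0) k) + (\<Sum>i<m. F d (t (Suc i)) (z - t i) - F d (t i) (z - t i))"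
        using eventually_ge_at_top[of 1] by eventually_elim (rule sF)
      show "(\<lambda>d. 1 - (F d (t m) k - F d (t 0) k) + (\<Sum>i<m. F d (t (Suc i)) (z - t i) - F d (t i) (z - t i)))
          \<longlonglongrightarrow> 1 - (G (t m) k - G (t 0) k) + (\<Sum>i<m. G (t (Suc i)) (z - t i) - G (t i) (z - t i))"
        by (intro tendsto_intros FG)
      have "(\<Sum>i<m. G (t (Suc i)) (z + \<eta> - t (Suc i)) - G (t i) (z + \<eta> - t (Suc i)))
          = (\<Sum>i<m. G (t (Suc i)) (z - t i) - G (t i) (z - t i))"
        by (simp add: t(2) algebra_simps)
      then show "1 - (G (t m) k - G (t 0) k) + (\<Sum>i<m. G (t (Suc i)) (z - t i) - G (t i) (z - t i)) \<le> c (z + \<eta>) + \<eta>"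
        using sG(1)[where z = "z + \<eta>" and m = m] tk by linarith
    qed
  qed (use lims in auto)
  moreover have "\<forall>\<^sub>F d in sequentially. g d = cdf (distr (M d) borel (\<lambda>\<omega>. U d \<omega> + V d \<omega>)) z"
    using eventually_ge_at_top[of 1]
  proof eventually_elim
    case (elim d)
    note [measurable] = UV[OF elim]
    show ?case by (auto simp: cdf_def g_def measure_distr intro!: arg_cong[where f = "measure (M d)"])
  qed
  ultimately have "(\<lambda>d. cdf (distr (M d) borel (\<lambda>\<omega>. U d \<omega> + V d \<omega>)) z) \<longlonglongrightarrow> c z"
    by (rule Lim_transform_eventually)
  then show "(\<lambda>d. cdf (distr (M d) borel (\<lambda>\<omega>. U d \<omega> + V d \<omega>)) z) \<longlonglongrightarrow> cdf (distr P borel (\<lambda>\<omega>. E \<omega> + E' \<omega>)) z"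
    by (simp add: cdfP)
qed

section \<open>Maximum and minimum of the norms\<close>

text \<open>No logarithm is taken: exp(-c) is the n-th power of exp(-c/n), and |s^n - t^n| <= n |s -
  t| for s, t in the unit interval. The right-hand side becomes the distance between n (1 -
  exp(-c/n)) and n r, which both tend to c.\<close>

lemma tendsto_one_minus_power:
  fixes r :: "'b \<Rightarrow> real" and n :: "'b \<Rightarrow> nat"
  assumes n: "filterlim n at_top F" and r: "((\<lambda>d. real (n d) * r d) \<longlongrightarrow> c) F"
    and r01: "\<forall>\<^sub>F d in F. 0 \<le> r d \<and> r d \<le> 1" and c: "c \<ge> 0"
  shows "((\<lambda>d. (1 - r d) ^ n d) \<longlongrightarrow> exp (- c)) F"
proof -
  have n0: "\<forall>\<^sub>F d in F. n d > 0" using n[unfolded filterlim_at_top, rule_format, of 1] by eventually_elim simp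
  have "((\<lambda>y::real. y * (1 - exp (- c / y))) \<longlongrightarrow> c) at_top" by real_asymp
  then have "((\<lambda>d. real (n d) * (1 - exp (- c / real (n d)))) \<longlongrightarrow> c) F"
    by (rule filterlim_compose) (rule filterlim_compose[OF filterlim_real_sequentially n])
  from tendsto_diff[OF this r]
  have lim: "((\<lambda>d. \<bar>real (n d) * (1 - exp (- c / real (n d))) - real (n d) * r d\<bar>) \<longlongrightarrow> 0) F"
    by (simp add: tendsto_rabs_zero_iff)
  have "((\<lambda>d. (1 - r d) ^ n d - exp (- c)) \<longlongrightarrow> 0) F"
  proof (rule Lim_null_comparison[OF _ lim])
    show "\<forall>\<^sub>F d in F. norm ((1 - r d) ^ n d - exp (- c)) \<le> \<bar>real (n d) * (1 - exp (- c / real (n d))) - real (n d) * r d\<bar>"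
      using n0 r01
    proof eventually_elim
      case (elim d)
      have "exp (- c) = exp (- c / real (n d)) ^ n d"
        using elim by (simp flip: exp_of_nat_mult)
      then have "norm ((1 - r d) ^ n d - exp (- c)) \<le> real (n d) * norm (1 - r d - exp (- c / real (n d)))"
        using elim c norm_power_diff[of "1 - r d" "exp (- c / real (n d))" "n d"] by simp
      also have "\<dots> = \<bar>real (n d) * (1 - r d - exp (- c / real (n d)))\<bar>" by (simp add: abs_mult)
      also have "\<dots> = \<bar>real (n d) * (1 - exp (- c / real (n d))) - real (n d) * r d\<bar>"
        by (simp add: algebra_simps)
      finally show ?case .
    qed
  qed
  then show ?thesis by (simp add: LIM_zero_iff)
qed

lemma (in prob_space) iid_all_in:
  assumes iid: "iid_vars M S Z {1..n}" and n: "n \<ge> 1" and A: "A \<in> sets S"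
  shows "prob {\<omega>\<in>space M. \<forall>i\<in>{1..n}. Z i \<omega> \<in> A} = prob {\<omega>\<in>space M. Z 1 \<omega> \<in> A} ^ n"
proof -
  have ind: "indep_vars (\<lambda>_. S) Z {1..n}"
    and law: "\<And>i. i \<in> {1..n} \<Longrightarrow> distr M S (Z i) = distr M S (Z 1)"
    using iid n unfolding iid_vars_def by (blast, metis atLeastAtMost_iff order_refl)
  have rv: "random_variable S (Z i)" if "i \<in> {1..n}" for i
    using ind that by (auto simp: indep_vars_def)
  have eq: "prob (Z i -` A \<inter> space M) = prob {\<omega>\<in>space M. Z 1 \<omega> \<in> A}" if i: "i \<in> {1..n}" for i
  proof -
    have "prob (Z i -` A \<inter> space M) = measure (distr M S (Z i)) A"
      using rv[OF i] A by (simp add: measure_distr)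
    also have "\<dots> = prob (Z 1 -` A \<inter> space M)"
      using rv[of 1] n A by (simp add: law[OF i] measure_distr)
    also have "Z 1 -` A \<inter> space M = {\<omega>\<in>space M. Z 1 \<omega> \<in> A}" by auto
    finally show ?thesis .
  qed
  have "{\<omega>\<in>space M. \<forall>i\<in>{1..n}. Z i \<omega> \<in> A} = (\<Inter>i\<in>{1..n}. Z i -` A \<inter> space M)"
    using n by auto
  then have "prob {\<omega>\<in>space M. \<forall>i\<in>{1..n}. Z i \<omega> \<in> A} = (\<Prod>i\<in>{1..n}. prob (Z i -` A \<inter> space M))"
    using indep_varsD[OF ind, of "{1..n}" "\<lambda>_. A"] n A by simp
  also have "\<dots> = prob {\<omega>\<in>space M. Z 1 \<omega> \<in> A} ^ n"
    using eq by simp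
  finally show ?thesis .
qed

text \<open>The reciprocal of (1/p) (d \<mu>)^(1/p - 1) \<sigma> sqrt d, which is the derivative of
  t^(1/p) at the mean d \<mu> of the sum of p-th powers times the standard deviation of that
  sum.\<close>

definition norm_scale :: "real \<Rightarrow> real \<Rightarrow> real \<Rightarrow> nat \<Rightarrow> real" where
  "norm_scale p \<mu> \<sigma> d = p * real d powr (1 / 2 - 1 / p) / (\<mu> powr (1 / p - 1) * \<sigma>)"

text \<open>The centre is the p-th root of the mean of the sum, not the mean of the norm. It is
  deterministic and the same for all vectors, so it cancels in the range.\<close>

definition std_lp_norm :: "real \<Rightarrow> real \<Rightarrow> real \<Rightarrow> nat \<Rightarrow> (nat \<Rightarrow> real) \<Rightarrow> real" where
  "std_lp_norm p \<mu> \<sigma> d x = norm_scale p \<mu> \<sigma> d * (lp_norm p d x - (real d * \<mu>) powr (1 / p))"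

text \<open>A level of the standardized norm, pulled back to the standardized sum of the \<open>p\<close>-th powers.\<close>

definition sum_level :: "real \<Rightarrow> real \<Rightarrow> real \<Rightarrow> nat \<Rightarrow> real \<Rightarrow> real" where
  "sum_level p \<mu> \<sigma> d w = sqrt d * \<mu> / \<sigma> * ((1 + w * \<sigma> / (p * sqrt d * \<mu>)) powr p - 1)"

text \<open>With r the sum of p-th powers divided by d \<mu>, and K = p sqrt d \<mu> / \<sigma>, the
  standardized norm is K (r^(1/p) - 1) and the standardized sum is (K/p) (r - 1). A level w of the
  first is r^(1/p) = 1 + w/K, and raising to the power p gives the level of the second. The
  condition on \<open>w\<close> keeps 1 + w/K positive, where this power is increasing.\<close>

lemma std_lp_norm_level:
  assumes d: "d \<ge> 1" and p: "p \<ge> 1" and \<mu>: "\<mu> > 0" and \<sigma>: "\<sigma> > 0"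
    and w: "1 + w * \<sigma> / (p * sqrt d * \<mu>) > 0"
  shows "std_lp_norm p \<mu> \<sigma> d x \<le> w \<longleftrightarrow> (\<Sum>j=1..d. (\<bar>x j\<bar> powr p - \<mu>) / (\<sigma> * sqrt d)) \<le> sum_level p \<mu> \<sigma> d w"
    and "w \<le> std_lp_norm p \<mu> \<sigma> d x \<longleftrightarrow> sum_level p \<mu> \<sigma> d w \<le> (\<Sum>j=1..d. (\<bar>x j\<bar> powr p - \<mu>) / (\<sigma> * sqrt d))"
proof -
  define A where "A = (\<Sum>j=1..d. \<bar>x j\<bar> powr p)"
  define r where "r = A / (d * \<mu>)"
  define D where "D = 1 + w * \<sigma> / (p * sqrt d * \<mu>)"
  define K where "K = p * sqrt d * \<mu> / \<sigma>"
  have K: "K > 0" using d p \<mu> \<sigma> by (simp add: K_def)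
  have A: "A \<ge> 0" by (auto simp: A_def intro!: sum_nonneg)
  have r: "r \<ge> 0" "A = r * (d * \<mu>)" using A d \<mu> by (auto simp: r_def)
  have "norm_scale p \<mu> \<sigma> d * (real d * \<mu>) powr (1 / p)
      = p / \<sigma> * (d powr (1 / 2 - 1 / p) * d powr (1 / p)) * (\<mu> powr (1 / p) / \<mu> powr (1 / p - 1))"
    using d \<mu> \<sigma> by (simp add: norm_scale_def powr_mult field_simps)
  also have "\<dots> = K"
    using d \<mu> by (simp add: K_def powr_half_sqrt flip: powr_add powr_diff)
  finally have K_eq: "norm_scale p \<mu> \<sigma> d * (real d * \<mu>) powr (1 / p) = K" .
  have "lp_norm p d x = r powr (1 / p) * (real d * \<mu>) powr (1 / p)"
    using d \<mu> r(1) by (simp add: lp_norm_def powr_mult[symmetric] r(2)[symmetric] A_def)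
  then have "std_lp_norm p \<mu> \<sigma> d x = norm_scale p \<mu> \<sigma> d * (real d * \<mu>) powr (1 / p) * (r powr (1 / p) - 1)"
    by (simp add: std_lp_norm_def algebra_simps)
  then have "std_lp_norm p \<mu> \<sigma> d x = K * (r powr (1 / p) - 1)"
    unfolding K_eq .
  moreover have "w = K * (D - 1)" using d p \<mu> \<sigma> by (simp add: K_def D_def)
  ultimately have 1: "std_lp_norm p \<mu> \<sigma> d x \<le> w \<longleftrightarrow> r powr (1 / p) \<le> D"
    "w \<le> std_lp_norm p \<mu> \<sigma> d x \<longleftrightarrow> D \<le> r powr (1 / p)"
    using K by auto
  have rp: "(r powr (1 / p)) powr p = r" using p r by (simp add: powr_powr)
  have 2: "r powr (1 / p) \<le> D \<longleftrightarrow> r \<le> D powr p" "D \<le> r powr (1 / p) \<longleftrightarrow> D powr p \<le> r"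
    using powr_mono2[of p "r powr (1 / p)" D] powr_less_mono2[of p D "r powr (1 / p)"]
      powr_mono2[of p D "r powr (1 / p)"] powr_less_mono2[of p "r powr (1 / p)" D] rp p w
    by (auto simp: D_def[symmetric] not_le[symmetric])
  have "(\<Sum>j=1..d. (\<bar>x j\<bar> powr p - \<mu>) / (\<sigma> * sqrt d)) = (A - d * \<mu>) / (\<sigma> * sqrt d)"
    by (simp add: A_def sum_subtractf flip: sum_divide_distrib)
  also have "\<dots> = sqrt d * \<mu> / \<sigma> * (r - 1)"
  proof -
    define q where "q = sqrt (real d)"
    have q: "q > 0" "q * q = real d" using d by (auto simp: q_def)
    have eq: "A - d * \<mu> = q * q * \<mu> * (r - 1)" using r(2) q(2) by (simp add: algebra_simps)
    show ?thesis unfolding eq q_def[symmetric] using q(1) by simp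
  qed
  finally have S: "(\<Sum>j=1..d. (\<bar>x j\<bar> powr p - \<mu>) / (\<sigma> * sqrt d)) = sqrt d * \<mu> / \<sigma> * (r - 1)" .
  have "sqrt d * \<mu> / \<sigma> > 0" using d \<mu> \<sigma> by simp
  then have "(\<Sum>j=1..d. (\<bar>x j\<bar> powr p - \<mu>) / (\<sigma> * sqrt d)) \<le> sum_level p \<mu> \<sigma> d w \<longleftrightarrow> r \<le> D powr p"
    "sum_level p \<mu> \<sigma> d w \<le> (\<Sum>j=1..d. (\<bar>x j\<bar> powr p - \<mu>) / (\<sigma> * sqrt d)) \<longleftrightarrow> D powr p \<le> r"
    unfolding S sum_level_def D_def[symmetric] by (auto simp only: mult_le_cancel_left_pos)
  then show "std_lp_norm p \<mu> \<sigma> d x \<le> w \<longleftrightarrow> (\<Sum>j=1..d. (\<bar>x j\<bar> powr p - \<mu>) / (\<sigma> * sqrt d)) \<le> sum_level p \<mu> \<sigma> d w"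
    "w \<le> std_lp_norm p \<mu> \<sigma> d x \<longleftrightarrow> sum_level p \<mu> \<sigma> d w \<le> (\<Sum>j=1..d. (\<bar>x j\<bar> powr p - \<mu>) / (\<sigma> * sqrt d))"
    using 1 2 by auto
qed

text \<open>Expand (1 + \<delta>)^p = 1 + p \<delta> + O(\<delta>^2) with \<delta> = w \<sigma> / (p
  sqrt d \<mu>). The prefactor sqrt d \<mu> / \<sigma> turns p \<delta> into w and the remainder
  into O(w^2 / sqrt d).\<close>

lemma sum_level_approx:
  fixes w a :: "nat \<Rightarrow> real"
  assumes p: "p \<ge> 1" and \<mu>: "\<mu> > 0" and \<sigma>: "\<sigma> > 0"
    and w: "(\<lambda>d. w d / sqrt d) \<longlonglongrightarrow> 0" and aw: "(\<lambda>d. a d * (w d)\<^sup>2 / sqrt d) \<longlonglongrightarrow> 0"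
  shows "(\<lambda>d. a d * (sum_level p \<mu> \<sigma> d (w d) - w d)) \<longlonglongrightarrow> 0"
    and "\<forall>\<^sub>F d in sequentially. 1 + w d * \<sigma> / (p * sqrt d * \<mu>) > 0"
proof -
  define \<delta> where "\<delta> d = w d * \<sigma> / (p * sqrt d * \<mu>)" for d :: nat
  have "(\<lambda>d. \<sigma> / (p * \<mu>) * (w d / sqrt d)) \<longlonglongrightarrow> 0"
    by (rule tendsto_mult_right_zero[OF w])
  then have \<delta>: "\<delta> \<longlonglongrightarrow> 0" by (simp add: \<delta>_def[abs_def] field_simps)
  have "\<forall>\<^sub>F d in sequentially. \<delta> d > - 1" by (rule order_tendstoD(1)[OF \<delta>]) simp
  then show "\<forall>\<^sub>F d in sequentially. 1 + w d * \<sigma> / (p * sqrt d * \<mu>) > 0"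
    by eventually_elim (simp add: \<delta>_def)
  have "(\<lambda>h::real. (1 + h) powr p - 1 - p * h) \<in> O[at 0](\<lambda>h. h ^ 2)" by real_asymp
  then obtain C where "\<forall>\<^sub>F h in at 0. norm ((1 + h) powr p - 1 - p * h) \<le> C * norm (h ^ 2 :: real)"
    by (elim landau_o.bigE)
  \<comment> \<open>The bound extends to \<open>h = 0\<close>, where both sides are 0; this is
    wanted because \<open>\<delta> d\<close> may vanish.\<close>
  then have "\<forall>\<^sub>F h in nhds (0::real). \<bar>(1 + h) powr p - 1 - p * h\<bar> \<le> C * h\<^sup>2"
    unfolding eventually_nhds_conv_at by simp
  then have C: "\<forall>\<^sub>F d in sequentially. \<bar>(1 + \<delta> d) powr p - 1 - p * \<delta> d\<bar> \<le> C * (\<delta> d)\<^sup>2"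
    by (rule eventually_compose_filterlim) (rule \<delta>)
  have lim: "(\<lambda>d. C * \<sigma> / (p\<^sup>2 * \<mu>) * \<bar>a d * (w d)\<^sup>2 / sqrt d\<bar>) \<longlonglongrightarrow> 0"
    using tendsto_mult_right_zero[OF tendsto_rabs_zero[OF aw]] .
  show "(\<lambda>d. a d * (sum_level p \<mu> \<sigma> d (w d) - w d)) \<longlonglongrightarrow> 0"
  proof (rule Lim_null_comparison[OF _ lim])
    show "\<forall>\<^sub>F d in sequentially. norm (a d * (sum_level p \<mu> \<sigma> d (w d) - w d)) \<le> C * \<sigma> / (p\<^sup>2 * \<mu>) * \<bar>a d * (w d)\<^sup>2 / sqrt d\<bar>"
      using C eventually_ge_at_top[of 1]
    proof eventually_elim
      case (elim d)
      define K where "K = sqrt d * \<mu> / \<sigma>"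
      have K: "K > 0" using elim \<mu> \<sigma> by (simp add: K_def)
      have "w d = K * (p * \<delta> d)" using elim p \<mu> \<sigma> by (simp add: K_def \<delta>_def)
      moreover have "sum_level p \<mu> \<sigma> d (w d) = K * ((1 + \<delta> d) powr p - 1)"
        by (simp only: sum_level_def \<delta>_def K_def)
      ultimately have "sum_level p \<mu> \<sigma> d (w d) - w d = K * ((1 + \<delta> d) powr p - 1 - p * \<delta> d)"
        by (simp add: right_diff_distrib)
      then have "norm (a d * (sum_level p \<mu> \<sigma> d (w d) - w d)) = \<bar>a d\<bar> * K * \<bar>(1 + \<delta> d) powr p - 1 - p * \<delta> d\<bar>"
        using K by (simp add: abs_mult)
      also have "\<dots> \<le> \<bar>a d\<bar> * K * (C * (\<delta> d)\<^sup>2)"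
        using elim K by (intro mult_left_mono) auto
      also have "\<dots> = C * \<sigma> / (p\<^sup>2 * \<mu>) * \<bar>a d * (w d)\<^sup>2 / sqrt d\<bar>"
        using elim p \<mu> \<sigma> by (simp add: K_def \<delta>_def abs_mult power2_eq_square field_simps)
      finally show ?case .
    qed
  qed
qed

text \<open>The growth condition gives n <= d^(1/5) eventually, so the quantity is at most d^(1/5 -
  1/2) times a power of ln d.\<close>

lemma a_norm_cube_rate:
  assumes n_lim: "filterlim n at_top sequentially"
    and n_growth: "(\<lambda>d. real (n d)) \<in> o[sequentially](\<lambda>d. real d powr (1 / 5) / ln (real d) powr (6 / 5))"
  shows "(\<lambda>d. real (n d) * a_norm (n d) ^ 3 / sqrt d) \<longlonglongrightarrow> 0"
proof -
  have "((\<lambda>x::real. x powr (1 / 5) * sqrt (2 * ln x) ^ 3 / sqrt x) \<longlongrightarrow> 0) at_top" by real_asymp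
  then have lim: "(\<lambda>d. real d powr (1 / 5) * sqrt (2 * ln (real d)) ^ 3 / sqrt d) \<longlonglongrightarrow> 0"
    by (rule filterlim_compose) (rule filterlim_real_sequentially)
  have "\<forall>\<^sub>F x::real in at_top. x powr (1 / 5) / ln x powr (6 / 5) \<le> x powr (1 / 5) \<and> x powr (1 / 5) \<le> x \<and> 1 \<le> x"
    by (intro eventually_conj; real_asymp)
  then have "\<forall>\<^sub>F d in sequentially. real d powr (1 / 5) / ln (real d) powr (6 / 5) \<le> real d powr (1 / 5) \<and> real d powr (1 / 5) \<le> real d \<and> 1 \<le> real d"
    by (rule eventually_compose_filterlim[OF _ filterlim_real_sequentially])
  moreover have "\<forall>\<^sub>F d in sequentially. norm (real (n d)) \<le> 1 * norm (real d powr (1 / 5) / ln (real d) powr (6 / 5))"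
    using landau_o.smallD[OF n_growth, of 1] by simp
  moreover have "\<forall>\<^sub>F d in sequentially. n d \<ge> 2"
    using n_lim by (simp add: filterlim_at_top)
  ultimately have "\<forall>\<^sub>F d in sequentially. norm (real (n d) * a_norm (n d) ^ 3 / sqrt d)
      \<le> real d powr (1 / 5) * sqrt (2 * ln (real d)) ^ 3 / sqrt d"
  proof eventually_elim
    case (elim d)
    then have n: "real (n d) \<le> real d powr (1 / 5)" "real (n d) \<le> real d" "real (n d) \<ge> 2" by auto
    then have "a_norm (n d) \<le> sqrt (2 * ln (real d))" "a_norm (n d) \<ge> 0"
      by (auto simp: a_norm_def)
    then show ?case using n
      by (auto simp: abs_mult intro!: divide_right_mono mult_mono power_mono)
  qed
  then show ?thesis by (rule Lim_null_comparison[OF _ lim])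
qed

section \<open>Moments of |X|^p and the tails of a single norm\<close>

lemma abs_powr_cube: "\<bar>x::real\<bar> powr (3 * p) = \<bar>\<bar>x\<bar> powr p\<bar> ^ 3"
proof -
  have "3 * p = p + p + p" by simp
  then show ?thesis by (simp only: power3_eq_cube powr_add abs_of_nonneg[OF powr_ge_zero])
qed

text \<open>A nonnegative variable with mean zero vanishes almost everywhere, and then its variance
  is zero too.\<close>

lemma abs_moment_pos:
  assumes N: "prob_space N" and X [measurable]: "X \<in> borel_measurable N"
    and moment: "integrable N (\<lambda>\<omega>. \<bar>X \<omega>\<bar> powr (3 * p))" and sd_pos: "abs_sd N X p > 0"
  shows "abs_moment N X p > 0"
proof (rule ccontr)
  \<comment> \<open>Integrability comes first, since the integral of a non-integrable function is 0
    by default and would then say nothing about the function.\<close>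
  have int: "integrable N (\<lambda>\<omega>. \<bar>X \<omega>\<bar> powr p)"
  proof (rule integrable_abs_powers(1)[OF N])
    show "(\<lambda>\<omega>. \<bar>X \<omega>\<bar> powr p) \<in> borel_measurable N" by measurable
    show "integrable N (\<lambda>\<omega>. \<bar>\<bar>X \<omega>\<bar> powr p\<bar> ^ 3)" using moment by (simp only: abs_powr_cube)
  qed
  assume "\<not> abs_moment N X p > 0"
  moreover have "abs_moment N X p \<ge> 0"
    unfolding abs_moment_def by (rule Bochner_Integration.integral_nonneg) simp
  ultimately have z: "(\<integral>\<omega>. \<bar>X \<omega>\<bar> powr p \<partial>N) = 0" by (simp only: abs_moment_def)
  then have "AE \<omega> in N. \<bar>X \<omega>\<bar> powr p = 0"
    using integral_nonneg_eq_0_iff_AE[OF int] by simp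
  then have "(\<integral>\<omega>. (\<bar>X \<omega>\<bar> powr p - 0)\<^sup>2 \<partial>N) = (\<integral>\<omega>. 0 \<partial>N)"
    by (intro integral_cong_AE) auto
  then show False using sd_pos by (simp add: abs_sd_def z)
qed

text \<open>Levels of the norm are pulled back to levels of the sum, with an error negligible on the
  Gumbel scale. The lower tail is the upper tail of the negated summands, whose mean, variance and
  third absolute moment are the same; hence the same limit on both sides although the law of |X|^p
  need not be symmetric.\<close>

lemma std_lp_norm_tails:
  fixes Z :: "nat \<Rightarrow> 'a \<Rightarrow> nat \<Rightarrow> real" and X :: "'b \<Rightarrow> real" and n :: "nat \<Rightarrow> nat" and w :: "nat \<Rightarrow> real"
  assumes p: "p \<ge> 1" and N: "prob_space N" and X [measurable]: "X \<in> borel_measurable N"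
    and moment: "integrable N (\<lambda>\<omega>. \<bar>X \<omega>\<bar> powr (3 * p))" and sd_pos: "abs_sd N X p > 0"
    and n: "filterlim n at_top sequentially"
    and rate: "(\<lambda>d. real (n d) * a_norm (n d) ^ 3 / sqrt d) \<longlonglongrightarrow> 0"
    and M: "\<And>d. d \<ge> 1 \<Longrightarrow> prob_space (M d)"
    and ind: "\<And>d. d \<ge> 1 \<Longrightarrow> prob_space.indep_vars (M d) (\<lambda>_. borel) (\<lambda>j \<omega>. Z d \<omega> j) {1..d}"
    and law: "\<And>d j. d \<ge> 1 \<Longrightarrow> j \<in> {1..d} \<Longrightarrow> distr (M d) borel (\<lambda>\<omega>. Z d \<omega> j) = distr N borel X"
    and w: "(\<lambda>d. a_norm (n d) * (w d - b_norm (n d))) \<longlonglongrightarrow> x"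
  shows "(\<lambda>d. real (n d) * measure (M d) {\<omega>\<in>space (M d).
            w d < std_lp_norm p (abs_moment N X p) (abs_sd N X p) d (Z d \<omega>)}) \<longlonglongrightarrow> exp (- x)"
    and "(\<lambda>d. real (n d) * measure (M d) {\<omega>\<in>space (M d).
            std_lp_norm p (abs_moment N X p) (abs_sd N X p) d (Z d \<omega>) < - w d}) \<longlonglongrightarrow> exp (- x)"
proof -
  interpret N: prob_space N by fact
  define \<mu> where "\<mu> = abs_moment N X p"
  define \<sigma> where "\<sigma> = abs_sd N X p"
  define T where "T \<omega> = \<bar>X \<omega>\<bar> powr p" for \<omega>
  define a where "a d = a_norm (n d)" for d
  have T [measurable]: "T \<in> borel_measurable N" unfolding T_def by measurable
  have T3: "integrable N (\<lambda>\<omega>. \<bar>T \<omega>\<bar> ^ 3)"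
    using moment by (simp only: T_def abs_powr_cube)
  note T12 = integrable_abs_powers[OF N T T3]
  have \<mu>: "\<mu> = N.expectation T" by (simp add: \<mu>_def abs_moment_def T_def[abs_def])
  have \<sigma>0: "\<sigma> > 0" using sd_pos by (simp add: \<sigma>_def)
  have \<sigma>: "\<sigma>\<^sup>2 = N.expectation (\<lambda>\<omega>. (T \<omega> - \<mu>)\<^sup>2)"
    unfolding \<sigma>_def abs_sd_def \<mu> T_def[abs_def] by (rule real_sqrt_pow2) (auto intro!: Bochner_Integration.integral_nonneg)
  have \<mu>0: "\<mu> > 0"
    unfolding \<mu>_def by (rule abs_moment_pos[OF N X moment sd_pos])
  have cube: "integrable N (\<lambda>\<omega>. \<bar>T \<omega> - \<mu>\<bar> ^ 3)"
  proof (rule Bochner_Integration.integrable_bound)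
    \<comment> \<open>The factor 8 is the cube of 2, from bounding the difference by twice the
      larger of \<open>\<bar>T \<omega>\<bar>\<close> and \<open>\<mu>\<close>.\<close>
    show "integrable N (\<lambda>\<omega>. 8 * (\<bar>T \<omega>\<bar> ^ 3 + \<mu> ^ 3))" using T3 by auto
    show "AE \<omega> in N. norm (\<bar>T \<omega> - \<mu>\<bar> ^ 3) \<le> norm (8 * (\<bar>T \<omega>\<bar> ^ 3 + \<mu> ^ 3))"
    proof (rule AE_I2)
      fix \<omega>
      have "\<bar>T \<omega> - \<mu>\<bar> ^ 3 \<le> (2 * max \<bar>T \<omega>\<bar> \<mu>) ^ 3" using \<mu>0 by (intro power_mono) auto
      also have "\<dots> = 8 * (max \<bar>T \<omega>\<bar> \<mu>) ^ 3" by (simp add: power_mult_distrib)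
      also have "\<dots> \<le> 8 * (\<bar>T \<omega>\<bar> ^ 3 + \<mu> ^ 3)" using \<mu>0 by (auto simp: max_def)
      finally show "norm (\<bar>T \<omega> - \<mu>\<bar> ^ 3) \<le> norm (8 * (\<bar>T \<omega>\<bar> ^ 3 + \<mu> ^ 3))" using \<mu>0 by simp
    qed
  qed auto
  define \<rho> where "\<rho> = N.expectation (\<lambda>\<omega>. \<bar>T \<omega> - \<mu>\<bar> ^ 3) / \<sigma> ^ 3"
  define h where "h d z = (\<bar>z\<bar> powr p - \<mu>) / (\<sigma> * sqrt (real d))" for d :: nat and z
  have h [measurable]: "h d \<in> borel_measurable borel" for d unfolding h_def by measurable
  have rvZ [measurable]: "(\<lambda>\<omega>. Z d \<omega> j) \<in> borel_measurable (M d)" if "d \<ge> 1" "j \<in> {1..d}" for d j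
    using ind[OF that(1), unfolded prob_space.indep_vars_def[OF M[OF that(1)]]] that(2) by blast
  have transfer: "integrable (M d) (\<lambda>\<omega>. f (Z d \<omega> j)) \<longleftrightarrow> integrable N (\<lambda>\<omega>. f (X \<omega>))"
    "(\<integral>\<omega>. f (Z d \<omega> j) \<partial>M d) = (\<integral>\<omega>. f (X \<omega>) \<partial>N)"
    if dj: "d \<ge> 1" "j \<in> {1..d}" and [measurable]: "f \<in> borel_measurable borel" for d j and f :: "real \<Rightarrow> real"
  proof -
    note [measurable] = rvZ[OF dj]
    have "integrable (M d) (\<lambda>\<omega>. f (Z d \<omega> j)) \<longleftrightarrow> integrable (distr (M d) borel (\<lambda>\<omega>. Z d \<omega> j)) f"
      by (subst integrable_distr_eq) auto
    then show "integrable (M d) (\<lambda>\<omega>. f (Z d \<omega> j)) \<longleftrightarrow> integrable N (\<lambda>\<omega>. f (X \<omega>))"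
      unfolding law[OF dj] by (subst (asm) integrable_distr_eq) auto
    have "(\<integral>\<omega>. f (Z d \<omega> j) \<partial>M d) = (\<integral>z. f z \<partial>distr (M d) borel (\<lambda>\<omega>. Z d \<omega> j))"
      by (subst integral_distr) auto
    then show "(\<integral>\<omega>. f (Z d \<omega> j) \<partial>M d) = (\<integral>\<omega>. f (X \<omega>) \<partial>N)"
      unfolding law[OF dj] by (subst (asm) integral_distr) auto
  qed
  have hX: "h d (X \<omega>) = (T \<omega> - \<mu>) / (\<sigma> * sqrt d)" for d \<omega> by (simp add: h_def T_def)
  \<comment> \<open>The sign \<open>s\<close> is 1 for the upper tail and -1 for the lower
    one.\<close>
  have indh: "prob_space.indep_vars (M d) (\<lambda>_. borel) (\<lambda>j \<omega>. s * h d (Z d \<omega> j)) {1..d}" if "d \<ge> 1" for d s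
    by (rule prob_space.indep_vars_compose2[OF M[OF that] ind[OF that]]) measurable
  have i3: "integrable (M d) (\<lambda>\<omega>. \<bar>h d (Z d \<omega> j)\<bar> ^ 3)"
    and e1: "(\<integral>\<omega>. h d (Z d \<omega> j) \<partial>M d) = 0"
    and e2: "(\<integral>\<omega>. (h d (Z d \<omega> j))\<^sup>2 \<partial>M d) = 1 / d"
    and e3: "(\<integral>\<omega>. \<bar>h d (Z d \<omega> j)\<bar> ^ 3 \<partial>M d) \<le> \<rho> / (d * sqrt d)"
    if dj: "d \<ge> 1" "j \<in> {1..d}" for d j
  proof -
    have a3: "\<bar>h d (X \<omega>)\<bar> ^ 3 = \<bar>T \<omega> - \<mu>\<bar> ^ 3 / (\<sigma> ^ 3 * (d * sqrt d))" for \<omega>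
      using \<sigma>0 by (simp add: hX abs_divide power_divide power_mult_distrib abs_mult power3_eq_cube)
    show "integrable (M d) (\<lambda>\<omega>. \<bar>h d (Z d \<omega> j)\<bar> ^ 3)"
      using transfer(1)[OF dj, of "\<lambda>z. \<bar>h d z\<bar> ^ 3"] cube by (simp add: a3)
    have "(\<integral>\<omega>. \<bar>h d (Z d \<omega> j)\<bar> ^ 3 \<partial>M d) = (\<integral>\<omega>. \<bar>T \<omega> - \<mu>\<bar> ^ 3 / (\<sigma> ^ 3 * (d * sqrt d)) \<partial>N)"
      using transfer(2)[OF dj, of "\<lambda>z. \<bar>h d z\<bar> ^ 3"] by (simp add: a3)
    also have "\<dots> = \<rho> / (d * sqrt d)" by (simp add: \<rho>_def)
    finally show "(\<integral>\<omega>. \<bar>h d (Z d \<omega> j)\<bar> ^ 3 \<partial>M d) \<le> \<rho> / (d * sqrt d)" by simp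
    have "(\<integral>\<omega>. h d (Z d \<omega> j) \<partial>M d) = (\<integral>\<omega>. (T \<omega> - \<mu>) / (\<sigma> * sqrt d) \<partial>N)"
      using transfer(2)[OF dj, of "h d"] by (simp add: hX)
    also have "\<dots> = 0" using T12(1) by (simp add: \<mu> N.prob_space)
    finally show "(\<integral>\<omega>. h d (Z d \<omega> j) \<partial>M d) = 0" .
    have "(\<integral>\<omega>. (h d (Z d \<omega> j))\<^sup>2 \<partial>M d) = (\<integral>\<omega>. (T \<omega> - \<mu>)\<^sup>2 / (\<sigma>\<^sup>2 * d) \<partial>N)"
      using transfer(2)[OF dj, of "\<lambda>z. (h d z)\<^sup>2"] by (simp add: hX power_divide power_mult_distrib)
    also have "\<dots> = 1 / d" using \<sigma>0 by (simp flip: \<sigma>)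
    finally show "(\<integral>\<omega>. (h d (Z d \<omega> j))\<^sup>2 \<partial>M d) = 1 / d" .
  qed
  have tail: "(\<lambda>d. real (n d) * measure (M d) {\<omega>\<in>space (M d). u d < (\<Sum>j=1..d. s * h d (Z d \<omega> j))}) \<longlonglongrightarrow> exp (- x)"
    if "(\<lambda>d. a_norm (n d) * (u d - b_norm (n d))) \<longlonglongrightarrow> x" and s: "\<bar>s\<bar> = 1" for u s
  proof (rule gumbel_scale_sum_tail_strict[OF n rate M indh _ _ _ _ that(1)])
    fix d j :: nat assume dj: "d \<ge> 1" "j \<in> {1..d}"
    have "\<bar>s * h d (Z d \<omega> j)\<bar> = \<bar>h d (Z d \<omega> j)\<bar>" for \<omega> using s by (simp add: abs_mult)
    then show "integrable (M d) (\<lambda>\<omega>. \<bar>s * h d (Z d \<omega> j)\<bar> ^ 3)"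
      "(\<integral>\<omega>. \<bar>s * h d (Z d \<omega> j)\<bar> ^ 3 \<partial>M d) \<le> \<rho> / (d * sqrt d)"
      using i3[OF dj] e3[OF dj] by simp_all
    show "(\<integral>\<omega>. s * h d (Z d \<omega> j) \<partial>M d) = 0" using e1[OF dj] by simp
    have "s\<^sup>2 = 1" using s by (metis power2_abs one_power2)
    then show "(\<integral>\<omega>. (s * h d (Z d \<omega> j))\<^sup>2 \<partial>M d) = 1 / d"
      using e2[OF dj] by (simp add: power_mult_distrib)
  qed auto
  have a: "filterlim a at_top sequentially" unfolding a_def by (rule a_norm_at_top) fact
  have ev: "\<forall>\<^sub>F d in sequentially. d \<ge> 1 \<and> n d \<ge> 2 \<and> a d \<ge> 1"
    using n[unfolded filterlim_at_top] a[unfolded filterlim_at_top] eventually_ge_at_top[of 1]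
    by (simp add: eventually_conj_iff)
  have a3: "(\<lambda>d. a d ^ 3 / sqrt d) \<longlonglongrightarrow> 0"
  proof (rule Lim_null_comparison[OF _ rate])
    show "\<forall>\<^sub>F d in sequentially. norm (a d ^ 3 / sqrt d) \<le> real (n d) * a_norm (n d) ^ 3 / sqrt d"
      using ev
    proof eventually_elim
      case (elim d)
      then have "1 * a d ^ 3 \<le> real (n d) * a d ^ 3" by (intro mult_right_mono) auto
      then show ?case using elim by (auto simp: a_def[symmetric] intro!: divide_right_mono)
    qed
  qed
  have a1: "(\<lambda>d. a d / sqrt d) \<longlonglongrightarrow> 0"
  proof (rule Lim_null_comparison[OF _ a3])
    show "\<forall>\<^sub>F d in sequentially. norm (a d / sqrt d) \<le> a d ^ 3 / sqrt d"
      using ev by eventually_elim (auto intro!: divide_right_mono self_le_power)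
  qed
  \<comment> \<open>By \<open>b_norm_eq\<close>, b/a tends to 1. The hypothesis controls a (w - b),
    so dividing by a^2 shows that w/a has the same limit.\<close>
  have wa: "(\<lambda>d. w d / a d) \<longlonglongrightarrow> 1"
  proof -
    have "((\<lambda>y::real. 1 - (ln (sqrt (2 * pi)) + ln y) / y ^ 2) \<longlongrightarrow> 1) at_top" by real_asymp
    then have b: "(\<lambda>d. 1 - (ln (sqrt (2 * pi)) + ln (a d)) / a d ^ 2) \<longlonglongrightarrow> 1"
      by (rule filterlim_compose) (rule a)
    have "(\<lambda>d. a d * (w d - b_norm (n d)) / (a d)\<^sup>2) \<longlonglongrightarrow> 0"
      using w by (intro real_tendsto_divide_at_top[where c = x] filterlim_pow_at_top a) (auto simp: a_def)
    from tendsto_add[OF b this]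
    have "(\<lambda>d. 1 - (ln (sqrt (2 * pi)) + ln (a d)) / a d ^ 2 + a d * (w d - b_norm (n d)) / (a d)\<^sup>2) \<longlonglongrightarrow> 1" by simp
    moreover have "\<forall>\<^sub>F d in sequentially. 1 - (ln (sqrt (2 * pi)) + ln (a d)) / a d ^ 2 + a d * (w d - b_norm (n d)) / (a d)\<^sup>2 = w d / a d"
      using ev
    proof eventually_elim
      case (elim d)
      then have b: "b_norm (n d) = a d - (ln (sqrt (2 * pi)) + ln (a d)) / a d"
        using b_norm_eq[of "n d"] by (simp add: a_def)
      show ?case unfolding b using elim by (simp add: field_simps power2_eq_square)
    qed
    ultimately show ?thesis by (rule Lim_transform_eventually)
  qed
  have ws: "(\<lambda>d. w d / sqrt d) \<longlonglongrightarrow> 0" "(\<lambda>d. a d * (w d)\<^sup>2 / sqrt d) \<longlonglongrightarrow> 0"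
  proof -
    have "(\<lambda>d. (w d / a d) * (a d / sqrt d)) \<longlonglongrightarrow> 0" using tendsto_mult[OF wa a1] by simp
    moreover have "\<forall>\<^sub>F d in sequentially. (w d / a d) * (a d / sqrt d) = w d / sqrt d"
      using ev by eventually_elim auto
    ultimately show "(\<lambda>d. w d / sqrt d) \<longlonglongrightarrow> 0" by (rule Lim_transform_eventually)
    \<comment> \<open>Since w is of order a, the quadratic error of the linearization is of order
      a^3 / sqrt d, which the rate controls.\<close>
    have "(\<lambda>d. (w d / a d)\<^sup>2 * (a d ^ 3 / sqrt d)) \<longlonglongrightarrow> 0" using tendsto_mult[OF tendsto_power[OF wa, of 2] a3] by simp
    moreover have "\<forall>\<^sub>F d in sequentially. (w d / a d)\<^sup>2 * (a d ^ 3 / sqrt d) = a d * (w d)\<^sup>2 / sqrt d"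
      using ev by eventually_elim (auto simp: power2_eq_square power3_eq_cube)
    ultimately show "(\<lambda>d. a d * (w d)\<^sup>2 / sqrt d) \<longlonglongrightarrow> 0" by (rule Lim_transform_eventually)
  qed
  note up = sum_level_approx[OF p \<mu>0 \<sigma>0 ws]
  have ws': "(\<lambda>d. - w d / sqrt d) \<longlonglongrightarrow> 0" "(\<lambda>d. a d * (- w d)\<^sup>2 / sqrt d) \<longlonglongrightarrow> 0"
    using tendsto_minus[OF ws(1)] ws(2) by simp_all
  note low = sum_level_approx[OF p \<mu>0 \<sigma>0 ws']
  have "(\<lambda>d. a d * (sum_level p \<mu> \<sigma> d (w d) - w d) + a d * (w d - b_norm (n d))) \<longlonglongrightarrow> 0 + x"
    using w by (intro tendsto_add up(1)) (simp add: a_def)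
  then have "(\<lambda>d. a_norm (n d) * (sum_level p \<mu> \<sigma> d (w d) - b_norm (n d))) \<longlonglongrightarrow> x"
    by (simp add: a_def algebra_simps)
  from tail[OF this, of 1]
  have "(\<lambda>d. real (n d) * measure (M d) {\<omega>\<in>space (M d). sum_level p \<mu> \<sigma> d (w d) < (\<Sum>j=1..d. h d (Z d \<omega> j))}) \<longlonglongrightarrow> exp (- x)"
    by simp
  moreover have "\<forall>\<^sub>F d in sequentially. real (n d) * measure (M d) {\<omega>\<in>space (M d). sum_level p \<mu> \<sigma> d (w d) < (\<Sum>j=1..d. h d (Z d \<omega> j))}
      = real (n d) * measure (M d) {\<omega>\<in>space (M d). w d < std_lp_norm p \<mu> \<sigma> d (Z d \<omega>)}"
    using up(2) ev
  proof eventually_elim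
    case (elim d)
    have "std_lp_norm p \<mu> \<sigma> d z \<le> w d \<longleftrightarrow> (\<Sum>j=1..d. (\<bar>z j\<bar> powr p - \<mu>) / (\<sigma> * sqrt d)) \<le> sum_level p \<mu> \<sigma> d (w d)" for z
      by (rule std_lp_norm_level(1)) (use elim p \<mu>0 \<sigma>0 in auto)
    then show ?case by (simp only: not_le[symmetric] h_def)
  qed
  ultimately show "(\<lambda>d. real (n d) * measure (M d) {\<omega>\<in>space (M d).
            w d < std_lp_norm p (abs_moment N X p) (abs_sd N X p) d (Z d \<omega>)}) \<longlonglongrightarrow> exp (- x)"
    unfolding \<mu>_def[symmetric] \<sigma>_def[symmetric] by (rule Lim_transform_eventually)
  \<comment> \<open>For the negated sum the relevant level is minus the pulled-back level of -w, and
    it agrees with w up to o(1/a).\<close>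
  have "(\<lambda>d. - (a d * (sum_level p \<mu> \<sigma> d (- w d) - (- w d))) + a d * (w d - b_norm (n d))) \<longlonglongrightarrow> - 0 + x"
    using w by (intro tendsto_add tendsto_minus low(1)) (simp add: a_def)
  moreover have "- (a d * (sum_level p \<mu> \<sigma> d (- w d) - (- w d))) + a d * (w d - b_norm (n d))
      = a_norm (n d) * (- sum_level p \<mu> \<sigma> d (- w d) - b_norm (n d))" for d
    by (simp add: a_def algebra_simps)
  ultimately have "(\<lambda>d. a_norm (n d) * (- sum_level p \<mu> \<sigma> d (- w d) - b_norm (n d))) \<longlonglongrightarrow> x"
    by simp
  from tail[OF this, of "- 1"]
  have "(\<lambda>d. real (n d) * measure (M d) {\<omega>\<in>space (M d). (\<Sum>j=1..d. h d (Z d \<omega> j)) < sum_level p \<mu> \<sigma> d (- w d)}) \<longlonglongrightarrow> exp (- x)"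
    by (simp add: sum_negf)
  moreover have "\<forall>\<^sub>F d in sequentially. real (n d) * measure (M d) {\<omega>\<in>space (M d). (\<Sum>j=1..d. h d (Z d \<omega> j)) < sum_level p \<mu> \<sigma> d (- w d)}
      = real (n d) * measure (M d) {\<omega>\<in>space (M d). std_lp_norm p \<mu> \<sigma> d (Z d \<omega>) < - w d}"
    using low(2) ev
  proof eventually_elim
    case (elim d)
    have "- w d \<le> std_lp_norm p \<mu> \<sigma> d z \<longleftrightarrow> sum_level p \<mu> \<sigma> d (- w d) \<le> (\<Sum>j=1..d. (\<bar>z j\<bar> powr p - \<mu>) / (\<sigma> * sqrt d))" for z
      by (rule std_lp_norm_level(2)) (use elim p \<mu>0 \<sigma>0 in auto)
    then show ?case by (simp only: not_le[symmetric] h_def)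
  qed
  ultimately show "(\<lambda>d. real (n d) * measure (M d) {\<omega>\<in>space (M d).
            std_lp_norm p (abs_moment N X p) (abs_sd N X p) d (Z d \<omega>) < - w d}) \<longlonglongrightarrow> exp (- x)"
    unfolding \<mu>_def[symmetric] \<sigma>_def[symmetric] by (rule Lim_transform_eventually)
qed

theorem proposition5:
  fixes p :: real
    and N :: "'b measure" and X :: "'b \<Rightarrow> real"
    and n :: "nat \<Rightarrow> nat"
    and M :: "nat \<Rightarrow> 'a measure"
    and XX :: "nat \<Rightarrow> nat \<Rightarrow> 'a \<Rightarrow> nat \<Rightarrow> real"
    and P :: "'c measure" and E E' :: "'c \<Rightarrow> real"
  assumes p: "p \<ge> 1"
    and N: "prob_space N"
    and X: "X \<in> borel_measurable N"
    and moment_finite: "integrable N (\<lambda>\<omega>. \<bar>X \<omega>\<bar> powr (3 * p))"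
    and moment_pos: "abs_moment N X (3 * p) > 0"
    and sd_pos: "abs_sd N X p > 0"
    and n_pos: "\<And>d. d \<ge> 1 \<Longrightarrow> n d \<ge> 1"
    and n_lim: "filterlim n at_top sequentially"
    and n_growth: "(\<lambda>d. real (n d)) \<in>
          o[sequentially](\<lambda>d. real d powr (1 / 5) / ln (real d) powr (6 / 5))"
    and M: "\<And>d. d \<ge> 1 \<Longrightarrow> prob_space (M d)"
    and vectors_iid: "\<And>d. d \<ge> 1 \<Longrightarrow> iid_vars (M d) (borel_vec d) (XX d) {1..n d}"
    and components_iid: "\<And>d i. d \<ge> 1 \<Longrightarrow> i \<in> {1..n d} \<Longrightarrow>
          iid_vars (M d) borel (\<lambda>j \<omega>. XX d i \<omega> j) {1..d}"
    and components_law: "\<And>d i j. d \<ge> 1 \<Longrightarrow> i \<in> {1..n d} \<Longrightarrow> j \<in> {1..d} \<Longrightarrow>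
          distr (M d) borel (\<lambda>\<omega>. XX d i \<omega> j) = distr N borel X"
    and P: "prob_space P"
    and indep: "prob_space.indep_var P borel E borel E'"
    and E_law: "\<And>x. \<P>(\<omega> in P. E \<omega> \<le> x) = exp (- exp (- x))"
    and E'_law: "\<And>x. \<P>(\<omega> in P. E' \<omega> \<le> x) = exp (- exp (- x))"
  shows "weak_conv_m
    (\<lambda>d. distr (M d) borel (\<lambda>\<omega>.
       p * a_norm (n d) * real d powr (1 / 2 - 1 / p)
         / (abs_moment N X p powr (1 / p - 1) * abs_sd N X p)
         * (Max ((\<lambda>i. lp_norm p d (XX d i \<omega>)) ` {1..n d})
            - Min ((\<lambda>i. lp_norm p d (XX d i \<omega>)) ` {1..n d}))
       - 2 * a_norm (n d) * b_norm (n d)))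
    (distr P borel (\<lambda>\<omega>. E \<omega> + E' \<omega>))"
proof -
  interpret P: prob_space P by fact
  have E: "E \<in> borel_measurable P" "E' \<in> borel_measurable P"
    using indep by (auto dest: P.indep_var_rv1 P.indep_var_rv2)
  define \<mu> where "\<mu> = abs_moment N X p"
  define \<sigma> where "\<sigma> = abs_sd N X p"
  define a where "a d = a_norm (n d)" for d
  define b where "b d = b_norm (n d)" for d
  define W where "W d x = std_lp_norm p \<mu> \<sigma> d x" for d x
  \<comment> \<open>\<open>U\<close> is the normalized maximum and \<open>V\<close> the normalized
    negative of the minimum. In \<open>U + V\<close> the centres cancel, and the two shifts by
    \<open>b d\<close> produce the term \<open>2 * a_norm (n d) * b_norm (n d)\<close>.\<close>
  define U where "U d \<omega> = a d * (norm_scale p \<mu> \<sigma> d * (Max ((\<lambda>i. lp_norm p d (XX d i \<omega>)) ` {1..n d}) - (real d * \<mu>) powr (1 / p)) - b d)" for d \<omega>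
  define V where "V d \<omega> = a d * (- (norm_scale p \<mu> \<sigma> d * (Min ((\<lambda>i. lp_norm p d (XX d i \<omega>)) ` {1..n d}) - (real d * \<mu>) powr (1 / p))) - b d)" for d \<omega>
  have \<sigma>0: "\<sigma> > 0" using sd_pos by (simp add: \<sigma>_def)
  have \<mu>0: "\<mu> > 0"
    unfolding \<mu>_def by (rule abs_moment_pos[OF N X moment_finite sd_pos])
  have statistic: "p * a_norm (n d) * real d powr (1 / 2 - 1 / p)
         / (abs_moment N X p powr (1 / p - 1) * abs_sd N X p)
         * (Max ((\<lambda>i. lp_norm p d (XX d i \<omega>)) ` {1..n d})
            - Min ((\<lambda>i. lp_norm p d (XX d i \<omega>)) ` {1..n d}))
       - 2 * a_norm (n d) * b_norm (n d) = U d \<omega> + V d \<omega>" for d \<omega>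
  proof -
    define s where "s = norm_scale p \<mu> \<sigma> d"
    have "p * a_norm (n d) * real d powr (1 / 2 - 1 / p)
         / (abs_moment N X p powr (1 / p - 1) * abs_sd N X p) = a d * s"
      by (simp add: s_def norm_scale_def a_def \<mu>_def \<sigma>_def)
    then show ?thesis
      unfolding U_def V_def s_def[symmetric] a_def[symmetric] b_def[symmetric]
      by (simp add: algebra_simps)
  qed
  have rvX [measurable]: "XX d i \<in> measurable (M d) (borel_vec d)" if "d \<ge> 1" "i \<in> {1..n d}" for d i
    using vectors_iid[OF that(1), unfolded iid_vars_def prob_space.indep_vars_def[OF M[OF that(1)]]] that(2)
    by blast
  have lp [measurable]: "lp_norm p d \<in> borel_measurable (borel_vec d)" for d
    unfolding lp_norm_def[abs_def] by measurable
  have W [measurable]: "W d \<in> borel_measurable (borel_vec d)" for d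
    unfolding W_def[abs_def] std_lp_norm_def by measurable
  have lpX: "(\<lambda>\<omega>. lp_norm p d (XX d i \<omega>)) \<in> borel_measurable (M d)" if "d \<ge> 1" "i \<in> {1..n d}" for d i
    using measurable_compose[OF rvX[OF that] lp] .
  have UV: "U d \<in> borel_measurable (M d)" "V d \<in> borel_measurable (M d)" if "d \<ge> 1" for d
  proof -
    have [measurable]: "(\<lambda>\<omega>. Max ((\<lambda>i. lp_norm p d (XX d i \<omega>)) ` {1..n d})) \<in> borel_measurable (M d)"
      "(\<lambda>\<omega>. Min ((\<lambda>i. lp_norm p d (XX d i \<omega>)) ` {1..n d})) \<in> borel_measurable (M d)"
      using lpX[OF that] by (auto intro!: borel_measurable_Max borel_measurable_Min)
    show "U d \<in> borel_measurable (M d)" "V d \<in> borel_measurable (M d)"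
      unfolding U_def[abs_def] V_def[abs_def] by measurable
  qed
  have rate: "(\<lambda>d. real (n d) * a_norm (n d) ^ 3 / sqrt d) \<longlonglongrightarrow> 0"
    by (rule a_norm_cube_rate[OF n_lim n_growth])
  have a_top: "filterlim a at_top sequentially" unfolding a_def by (rule a_norm_at_top) fact
  have b_top: "filterlim b at_top sequentially"
  proof -
    have "filterlim (\<lambda>y::real. y - (ln (sqrt (2 * pi)) + ln y) / y) at_top at_top" by real_asymp
    then have "filterlim (\<lambda>d. a d - (ln (sqrt (2 * pi)) + ln (a d)) / a d) at_top sequentially"
      by (rule filterlim_compose) (rule a_top)
    moreover have "\<forall>\<^sub>F d in sequentially. a d - (ln (sqrt (2 * pi)) + ln (a d)) / a d = b d"
      using n_lim[unfolded filterlim_at_top, rule_format, of 2]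
      by eventually_elim (simp add: a_def b_def b_norm_eq)
    ultimately show ?thesis by (subst (asm) filterlim_cong[OF refl refl])
  qed
  have ind1: "prob_space.indep_vars (M d) (\<lambda>_. borel) (\<lambda>j \<omega>. XX d 1 \<omega> j) {1..d}" if "d \<ge> 1" for d
    using components_iid[OF that, of 1] n_pos[OF that] by (simp add: iid_vars_def)
  have law1: "distr (M d) borel (\<lambda>\<omega>. XX d 1 \<omega> j) = distr N borel X" if "d \<ge> 1" "j \<in> {1..d}" for d j
    using components_law[OF that(1), of 1 j] n_pos[OF that(1)] that by simp
  have pos: "\<forall>\<^sub>F d in sequentially. d \<ge> 1 \<and> a d > 0"
    using a_top[unfolded filterlim_at_top_dense] eventually_ge_at_top[of 1]
    by (simp add: eventually_conj_iff)
  have tails: "(\<lambda>d. real (n d) * measure (M d) {\<omega>\<in>space (M d). b d + x / a d < W d (XX d 1 \<omega>)}) \<longlonglongrightarrow> exp (- x)"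
    "(\<lambda>d. real (n d) * measure (M d) {\<omega>\<in>space (M d). W d (XX d 1 \<omega>) < - (b d + x / a d)}) \<longlonglongrightarrow> exp (- x)" for x
  proof -
    have "\<forall>\<^sub>F d in sequentially. x = a_norm (n d) * (b d + x / a d - b_norm (n d))"
      using pos by eventually_elim (simp add: a_def b_def)
    then have w: "(\<lambda>d. a_norm (n d) * (b d + x / a d - b_norm (n d))) \<longlonglongrightarrow> x"
      by (rule Lim_transform_eventually[OF tendsto_const])
    note t = std_lp_norm_tails[OF p N X moment_finite sd_pos n_lim rate M ind1 law1 w]
    show "(\<lambda>d. real (n d) * measure (M d) {\<omega>\<in>space (M d). b d + x / a d < W d (XX d 1 \<omega>)}) \<longlonglongrightarrow> exp (- x)"
      "(\<lambda>d. real (n d) * measure (M d) {\<omega>\<in>space (M d). W d (XX d 1 \<omega>) < - (b d + x / a d)}) \<longlonglongrightarrow> exp (- x)"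
      using t by (simp_all add: W_def \<mu>_def \<sigma>_def)
  qed
  have joint: "(\<lambda>d. measure (M d) {\<omega>\<in>space (M d). U d \<omega> \<le> x \<and> V d \<omega> \<le> y})
      \<longlonglongrightarrow> measure P {\<omega>\<in>space P. E \<omega> \<le> x \<and> E' \<omega> \<le> y}" for x y
  proof -
    \<comment> \<open>The probability that a single vector violates one of the two bounds. The first
      vector stands for all of them by equality of laws.\<close>
    define r where "r d = measure (M d) {\<omega>\<in>space (M d). b d + x / a d < W d (XX d 1 \<omega>)}
        + measure (M d) {\<omega>\<in>space (M d). W d (XX d 1 \<omega>) < - (b d + y / a d)}" for d
    have nr: "(\<lambda>d. real (n d) * r d) \<longlonglongrightarrow> exp (- x) + exp (- y)"
      unfolding r_def distrib_left by (intro tendsto_add tails)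
    have e: "(\<lambda>d. (b d + x / a d) + (b d + y / a d)) = (\<lambda>d. (x + y) / a d + (b d + b d))"
      by (auto simp: add_divide_distrib)
    \<comment> \<open>As \<open>b\<close> tends to infinity, the lower level eventually lies below
      the upper one. Then the two violations are disjoint events and \<open>r d\<close> is exactly
      the probability of their union.\<close>
    have "filterlim (\<lambda>d. (b d + x / a d) + (b d + y / a d)) at_top sequentially"
      unfolding e
      by (rule filterlim_tendsto_add_at_top[OF real_tendsto_divide_at_top[OF tendsto_const a_top]
            filterlim_at_top_add_at_top[OF b_top b_top]])
    then have "\<forall>\<^sub>F d in sequentially. (b d + x / a d) + (b d + y / a d) > 0"
      unfolding filterlim_at_top_dense by blast
    with pos have ev: "\<forall>\<^sub>F d in sequentially. d \<ge> 1 \<and> a d > 0 \<and> - (b d + y / a d) < b d + x / a d"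
      by eventually_elim linarith
    have r: "\<forall>\<^sub>F d in sequentially. measure (M d) {\<omega>\<in>space (M d). U d \<omega> \<le> x \<and> V d \<omega> \<le> y} = (1 - r d) ^ n d
        \<and> 0 \<le> r d \<and> r d \<le> 1"
      using ev
    proof eventually_elim
      case (elim d)
      interpret prob_space "M d" using M elim by simp
      have n1: "n d \<ge> 1" using n_pos elim by simp
      note [measurable] = rvX[of d 1]
      let ?u = "b d + x / a d" and ?l = "- (b d + y / a d)"
      let ?A = "{z\<in>space (borel_vec d). ?l \<le> W d z \<and> W d z \<le> ?u}"
      have [measurable]: "(\<lambda>\<omega>. W d (XX d 1 \<omega>)) \<in> borel_measurable (M d)"
        using measurable_compose[OF rvX[of d 1] W] elim n1 by simp
      have A: "?A \<in> sets (borel_vec d)" by measurable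
      have s: "norm_scale p \<mu> \<sigma> d > 0"
        using elim p \<mu>0 \<sigma>0 by (simp add: norm_scale_def)
      have "U d \<omega> \<le> x \<longleftrightarrow> (\<forall>i\<in>{1..n d}. W d (XX d i \<omega>) \<le> ?u)" for \<omega>
      proof -
        have "U d \<omega> \<le> x \<longleftrightarrow> Max ((\<lambda>i. lp_norm p d (XX d i \<omega>)) ` {1..n d}) \<le> ?u / norm_scale p \<mu> \<sigma> d + (real d * \<mu>) powr (1 / p)"
          unfolding U_def using elim s by (simp add: field_simps)
        also have "\<dots> \<longleftrightarrow> (\<forall>i\<in>{1..n d}. lp_norm p d (XX d i \<omega>) \<le> ?u / norm_scale p \<mu> \<sigma> d + (real d * \<mu>) powr (1 / p))"
          using n1 by (subst Max_le_iff) auto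
        finally show ?thesis unfolding W_def std_lp_norm_def using s by (simp add: field_simps)
      qed
      moreover have "V d \<omega> \<le> y \<longleftrightarrow> (\<forall>i\<in>{1..n d}. ?l \<le> W d (XX d i \<omega>))" for \<omega>
      proof -
        have "V d \<omega> \<le> y \<longleftrightarrow> ?l / norm_scale p \<mu> \<sigma> d + (real d * \<mu>) powr (1 / p) \<le> Min ((\<lambda>i. lp_norm p d (XX d i \<omega>)) ` {1..n d})"
          unfolding V_def using elim s by (simp add: field_simps)
        also have "\<dots> \<longleftrightarrow> (\<forall>i\<in>{1..n d}. ?l / norm_scale p \<mu> \<sigma> d + (real d * \<mu>) powr (1 / p) \<le> lp_norm p d (XX d i \<omega>))"
          using n1 by (subst Min_ge_iff) auto
        finally show ?thesis unfolding W_def std_lp_norm_def using s by (simp add: field_simps)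
      qed
      \<comment> \<open>Membership in \<open>?A\<close> includes being in
        \<open>space (borel_vec d)\<close>, a set of extensional functions; measurability of the
        vectors supplies this part.\<close>
      ultimately have e1: "{\<omega>\<in>space (M d). U d \<omega> \<le> x \<and> V d \<omega> \<le> y} = {\<omega>\<in>space (M d). \<forall>i\<in>{1..n d}. XX d i \<omega> \<in> ?A}"
        using measurable_space[OF rvX] elim by fastforce
      have e2: "prob {\<omega>\<in>space (M d). \<forall>i\<in>{1..n d}. XX d i \<omega> \<in> ?A} = prob {\<omega>\<in>space (M d). XX d 1 \<omega> \<in> ?A} ^ n d"
        by (rule iid_all_in[OF vectors_iid n1 A]) (use elim in simp)
      have e3: "prob {\<omega>\<in>space (M d). XX d 1 \<omega> \<in> ?A} = 1 - r d"
      proof -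
        let ?B = "{\<omega>\<in>space (M d). ?u < W d (XX d 1 \<omega>)} \<union> {\<omega>\<in>space (M d). W d (XX d 1 \<omega>) < ?l}"
        have "{\<omega>\<in>space (M d). XX d 1 \<omega> \<in> ?A} = space (M d) - ?B"
          using measurable_space[OF rvX[of d 1]] elim n1 by auto
        moreover have "prob (space (M d) - ?B) = 1 - prob ?B"
          by (rule prob_compl) measurable
        moreover have "prob ?B = r d"
          unfolding r_def
        proof (rule finite_measure_Union)
          show "{\<omega>\<in>space (M d). ?u < W d (XX d 1 \<omega>)} \<in> sets (M d)" by measurable
          show "{\<omega>\<in>space (M d). W d (XX d 1 \<omega>) < ?l} \<in> sets (M d)" by measurable
        qed (use elim in auto)
        ultimately show ?thesis by simp
      qed
      have "prob {\<omega>\<in>space (M d). U d \<omega> \<le> x \<and> V d \<omega> \<le> y} = (1 - r d) ^ n d"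
        by (simp only: e1 e2 e3)
      moreover have "0 \<le> r d" by (simp add: r_def)
      moreover have "r d \<le> 1"
      proof -
        have "0 \<le> 1 - r d" unfolding e3[symmetric] by (rule measure_nonneg)
        then show ?thesis by simp
      qed
      ultimately show ?case by simp
    qed
    \<comment> \<open>The two tail limits add in the exponent, so the limit factors into two Gumbel
      distribution functions: independence of \<open>E\<close> and \<open>E'\<close> appears
      here.\<close>
    have "(\<lambda>d. (1 - r d) ^ n d) \<longlonglongrightarrow> exp (- (exp (- x) + exp (- y)))"
      by (rule tendsto_one_minus_power[OF n_lim nr]) (use r in \<open>auto elim: eventually_mono\<close>)
    moreover have "measure P {\<omega>\<in>space P. E \<omega> \<le> x \<and> E' \<omega> \<le> y} = exp (- (exp (- x) + exp (- y)))"
    proof -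
      have "measure P {\<omega>\<in>space P. E \<omega> \<le> x \<and> E' \<omega> \<le> y}
          = P.prob (E -` {..x} \<inter> space P \<inter> (E' -` {..y} \<inter> space P))"
        by (rule arg_cong[where f = P.prob]) auto
      also have "\<dots> = P.prob (E -` {..x} \<inter> space P) * P.prob (E' -` {..y} \<inter> space P)"
        using P.indep_varD[OF indep, of "{..x}" "{..y}"] by (simp add: vimage_def Int_def conj_ac)
      also have "E -` {..x} \<inter> space P = {\<omega>\<in>space P. E \<omega> \<le> x}" by auto
      also have "E' -` {..y} \<inter> space P = {\<omega>\<in>space P. E' \<omega> \<le> y}" by auto
      finally show ?thesis by (simp add: E_law E'_law exp_add[symmetric])
    qed
    moreover have "\<forall>\<^sub>F d in sequentially. (1 - r d) ^ n d = measure (M d) {\<omega>\<in>space (M d). U d \<omega> \<le> x \<and> V d \<omega> \<le> y}"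
      using r by eventually_elim simp
    ultimately show ?thesis using Lim_transform_eventually by fastforce
  qed
  show ?thesis
    unfolding statistic
    by (rule weak_conv_sum_of_joint_cdf[OF M UV P E joint])
qed

end
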